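(* Let $R$ be a ring, let $\mathcal C$ be a full subcategory of $\operatorname{Mod-}R$ all of whose objects are slender right $R$-modules, and let $\mathcal P$ be a completely prime ideal of $\mathcal C$. Let $\{A_i\mid i\in I\}$ and $\{B_j\mid j\in J\}$ be families of objects of $\mathcal C$ with $|I|$, $|J|$ non-measurable. Assume: (a) for every object $A$ of $\mathcal C$, $\mathcal P(A,A)$ is a maximal right ideal of $\operatorname{End}_R(A)$; (b) in each of the two families, each $\mathcal P$ class contains at most countably many members; (c) $\prod_{i\in I}A_i\cong\prod_{j\in J}B_j$. Then there is a bijection $\sigma\colon I\to J$ with $[A_i]_{\mathcal P}=[B_{\sigma(i)}]_{\mathcal P}$ for every $i\in I$.
   Context: A completely prime ideal $\mathcal P$ of a full subcategory $\mathcal C$ of $\operatorname{Mod-}R$ consists of a subgroup $\mathcal P(A,B)$ of $\operatorname{Hom}_R(A,B)$ for each pair of objects $A,B$ of $\mathcal C$ such that: (1) for all objects $A,B,C$ and morphisms $f\colon A\to B$, $g\colon B\to C$, one has $gf\in\mathcal P(A,C)$ if and only if $f\in\mathcal P(A,B)$ or $g\in\mathcal P(B,C)$; (2) $\mathcal P(A,A)\neq\operatorname{Hom}_R(A,A)$ for every object $A$. For objects $A,B$, write $[A]_{\mathcal P}=[B]_{\mathcal P}$ ("same $\mathcal P$ class") if $\mathcal P(A,B)\ne\operatorname{Hom}_R(A,B)$ and $\mathcal P(B,A)\neq\operatorname{Hom}_R(B,A)$. A right $R$-module $M$ is slender if for every homomorphism $f\colon R^\omega=\prod_{n<\omega}e_nR\to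 M$ (with $e_n$ the element having $1$ in position $n$ and $0$ elsewhere) there is $n_0$ with $f(e_n)=0$ for all $n\ge n_0$. *)

theory Defs
  imports Main "HOL-Library.FuncSet" "HOL-Library.Countable_Set"
begin

record ('r, 'm) rmod =
  mcarrier :: "'m set"
  madd :: "'m \<Rightarrow> 'm \<Rightarrow> 'm"
  mzero :: 'm
  mneg :: "'m \<Rightarrow> 'm"
  msmult :: "'m \<Rightarrow> 'r \<Rightarrow> 'm"

definition right_module :: "('r::ring_1, 'm) rmod \<Rightarrow> bool" where
  "right_module M \<longleftrightarrow>
     mzero M \<in> mcarrier M \<and>
     (\<forall>x\<in>mcarrier M. \<forall>y\<in>mcarrier M. madd M x y \<in> mcarrier M) \<and>
     (\<forall>x\<in>mcarrier M. mneg M x \<in> mcarrier M) \<and>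
     (\<forall>x\<in>mcarrier M. \<forall>r. msmult M x r \<in> mcarrier M) \<and>
     (\<forall>x\<in>mcarrier M. \<forall>y\<in>mcarrier M. \<forall>z\<in>mcarrier M.
        madd M (madd M x y) z = madd M x (madd M y z)) \<and>
     (\<forall>x\<in>mcarrier M. \<forall>y\<in>mcarrier M. madd M x y = madd M y x) \<and>
     (\<forall>x\<in>mcarrier M. madd M (mzero M) x = x) \<and>
     (\<forall>x\<in>mcarrier M. madd M (mneg M x) x = mzero M) \<and>
     (\<forall>x\<in>mcarrier M. \<forall>y\<in>mcarrier M. \<forall>r.
        msmult M (madd M x y) r = madd M (msmult M x r) (msmult M y r)) \<and>
     (\<forall>x\<in>mcarrier M. \<forall>r s.
        msmult M x (r + s) = madd M (msmult M x r) (msmult M x s)) \<and>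
     (\<forall>x\<in>mcarrier M. \<forall>r s. msmult M x (r * s) = msmult M (msmult M x r) s) \<and>
     (\<forall>x\<in>mcarrier M. msmult M x 1 = x)"

definition rhom :: "('r::ring_1, 'm) rmod \<Rightarrow> ('r, 'n) rmod \<Rightarrow> ('m \<Rightarrow> 'n) set" where
  "rhom M N = {f. f \<in> mcarrier M \<rightarrow>\<^sub>E mcarrier N \<and>
     (\<forall>x\<in>mcarrier M. \<forall>y\<in>mcarrier M. f (madd M x y) = madd N (f x) (f y)) \<and>
     (\<forall>x\<in>mcarrier M. \<forall>r. f (msmult M x r) = msmult N (f x) r)}"

definition hzero :: "('r, 'm) rmod \<Rightarrow> ('r, 'n) rmod \<Rightarrow> 'm \<Rightarrow> 'n" where
  "hzero M N = (\<lambda>x\<in>mcarrier M. mzero N)"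

definition hadd :: "('r, 'm) rmod \<Rightarrow> ('r, 'n) rmod \<Rightarrow> ('m \<Rightarrow> 'n) \<Rightarrow> ('m \<Rightarrow> 'n) \<Rightarrow> 'm \<Rightarrow> 'n" where
  "hadd M N f g = (\<lambda>x\<in>mcarrier M. madd N (f x) (g x))"

definition hneg :: "('r, 'm) rmod \<Rightarrow> ('r, 'n) rmod \<Rightarrow> ('m \<Rightarrow> 'n) \<Rightarrow> 'm \<Rightarrow> 'n" where
  "hneg M N f = (\<lambda>x\<in>mcarrier M. mneg N (f x))"

definition hom_subgroup :: "('r::ring_1, 'm) rmod \<Rightarrow> ('r, 'n) rmod \<Rightarrow> ('m \<Rightarrow> 'n) set \<Rightarrow> bool" where
  "hom_subgroup M N S \<longleftrightarrow> S \<subseteq> rhom M N \<and> hzero M N \<in> S \<and>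
     (\<forall>f\<in>S. \<forall>g\<in>S. hadd M N f g \<in> S) \<and> (\<forall>f\<in>S. hneg M N f \<in> S)"

text \<open>A full subcategory is given by its class of objects C; morphisms are all R-homomorphisms.
  Composition gf (first f then g) is compose (mcarrier A) g f.\<close>
definition completely_prime_ideal ::
  "('r::ring_1, 'm) rmod set \<Rightarrow> (('r, 'm) rmod \<Rightarrow> ('r, 'm) rmod \<Rightarrow> ('m \<Rightarrow> 'm) set) \<Rightarrow> bool" where
  "completely_prime_ideal C P \<longleftrightarrow>
     (\<forall>A\<in>C. \<forall>B\<in>C. hom_subgroup A B (P A B)) \<and>
     (\<forall>A\<in>C. \<forall>B\<in>C. \<forall>D\<in>C. \<forall>f\<in>rhom A B. \<forall>g\<in>rhom B D.
        (compose (mcarrier A) g f \<in> P A D \<longleftrightarrow> f \<in> P A B \<or> g \<in> P B D)) \<and>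
     (\<forall>A\<in>C. P A A \<noteq> rhom A A)"

definition same_class ::
  "(('r::ring_1, 'm) rmod \<Rightarrow> ('r, 'm) rmod \<Rightarrow> ('m \<Rightarrow> 'm) set) \<Rightarrow> ('r, 'm) rmod \<Rightarrow> ('r, 'm) rmod \<Rightarrow> bool" where
  "same_class P A B \<longleftrightarrow> P A B \<noteq> rhom A B \<and> P B A \<noteq> rhom B A"

definition end_right_ideal :: "('r::ring_1, 'm) rmod \<Rightarrow> ('m \<Rightarrow> 'm) set \<Rightarrow> bool" where
  "end_right_ideal A S \<longleftrightarrow> hom_subgroup A A S \<and>
     (\<forall>f\<in>S. \<forall>h\<in>rhom A A. compose (mcarrier A) f h \<in> S)"

definition end_maximal_right_ideal :: "('r::ring_1, 'm) rmod \<Rightarrow> ('m \<Rightarrow> 'm) set \<Rightarrow> bool" where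
  "end_maximal_right_ideal A S \<longleftrightarrow> end_right_ideal A S \<and> S \<noteq> rhom A A \<and>
     (\<forall>T. end_right_ideal A T \<and> S \<subseteq> T \<longrightarrow> T = S \<or> T = rhom A A)"

definition Romega :: "('r::ring_1, nat \<Rightarrow> 'r) rmod" where
  "Romega = \<lparr>mcarrier = UNIV, madd = (\<lambda>x y n. x n + y n), mzero = (\<lambda>n. 0),
     mneg = (\<lambda>x n. - x n), msmult = (\<lambda>x r n. x n * r)\<rparr>"

definition unit_vec :: "nat \<Rightarrow> nat \<Rightarrow> 'r::ring_1" where
  "unit_vec n = (\<lambda>k. if k = n then 1 else 0)"

definition slender :: "('r::ring_1, 'm) rmod \<Rightarrow> bool" where
  "slender M \<longleftrightarrow> (\<forall>f\<in>rhom (Romega :: ('r, nat \<Rightarrow> 'r) rmod) M.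
      \<exists>n0. \<forall>n\<ge>n0. f (unit_vec n) = mzero M)"

definition rprod :: "'i set \<Rightarrow> ('i \<Rightarrow> ('r, 'm) rmod) \<Rightarrow> ('r, 'i \<Rightarrow> 'm) rmod" where
  "rprod I A = \<lparr>mcarrier = (\<Pi>\<^sub>E i\<in>I. mcarrier (A i)),
     madd = (\<lambda>x y. \<lambda>i\<in>I. madd (A i) (x i) (y i)),
     mzero = (\<lambda>i\<in>I. mzero (A i)),
     mneg = (\<lambda>x. \<lambda>i\<in>I. mneg (A i) (x i)),
     msmult = (\<lambda>x r. \<lambda>i\<in>I. msmult (A i) (x i) r)\<rparr>"

definition rmod_iso :: "('r::ring_1, 'm) rmod \<Rightarrow> ('r, 'n) rmod \<Rightarrow> bool" where
  "rmod_iso M N \<longleftrightarrow> (\<exists>f. f \<in> rhom M N \<and> bij_betw f (mcarrier M) (mcarrier N))"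

text \<open>|I| is (Ulam-)measurable iff I carries a non-principal countably complete ultrafilter.\<close>
definition measurable_card :: "'i set \<Rightarrow> bool" where
  "measurable_card I \<longleftrightarrow> (\<exists>U :: 'i set set. U \<subseteq> Pow I \<and> I \<in> U \<and> {} \<notin> U \<and>
     (\<forall>X\<in>U. \<forall>Y. X \<subseteq> Y \<and> Y \<subseteq> I \<longrightarrow> Y \<in> U) \<and>
     (\<forall>X. X \<subseteq> I \<longrightarrow> X \<in> U \<or> I - X \<in> U) \<and>
     (\<forall>F :: nat \<Rightarrow> 'i set. (\<forall>n. F n \<in> U) \<longrightarrow> (\<Inter>n. F n) \<in> U) \<and>
     (\<forall>x\<in>I. {x} \<notin> U))"

end

theory Submission
  imports Defs "HOL-Algebra.Product_Groups" "HOL-Algebra.QuotRing" "HOL-Algebra.UnivPoly"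
    "HOL-Library.Disjoint_Sets"
begin

text \<open>
  Let \<open>f\<close> be a homomorphism from a product to a slender module. The index sets on which \<open>f\<close> vanishes
  hereditarily along a fixed element form a sigma-ideal, and slenderness excludes infinitely many
  disjoint sets outside it. If \<open>f\<close> vanished on the factors but not on the product, some index set
  would be an atom outside this ideal and yield a nonprincipal countably complete ultrafilter. Over
  a non-measurable index set, \<open>f\<close> is therefore a finite sum of homomorphisms of the factors.

  Hence, for mutually inverse \<open>\<alpha>\<close> and \<open>\<beta>\<close> between the two products, each component of \<open>\<beta>\<alpha>\<close> is a
  finite sum of composites through the \<open>B j\<close>, and modulo \<open>P\<close> only the \<open>B j\<close> in the class at hand
  contribute. For \<open>U\<close> in that class, \<open>End(U)/P(U,U)\<close> is a division ring, because \<open>P(U,U)\<close> is a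
  maximal right ideal, and a homogeneous linear system over it with more unknowns than equations has
  a nontrivial solution. So \<open>n\<close> factors \<open>A i\<close> of the class cannot be recovered from fewer than \<open>n\<close>
  factors \<open>B j\<close>, and by symmetry and countability each class occurs equally often in both families.
\<close>

section \<open>Products in commutative groups\<close>

lemma hom_finprod:
  assumes G: "comm_group G" and H: "comm_group H" and h: "h \<in> hom G H" and f: "f \<in> S \<rightarrow> carrier G"
  shows "h (finprod G f S) = finprod H (\<lambda>i. h (f i)) S"
proof -
  interpret G: comm_group G by (rule G)
  interpret H: comm_group H by (rule H)
  show ?thesis
    using f
  proof (induction S rule: infinite_finite_induct)
    case (insert i S)
    have "h (f k) \<in> carrier H" if "k \<in> insert i S" for k
      using hom_in_carrier[OF h] insert.prems that by blast
    then show ?case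
      using insert by (simp add: hom_mult[OF h] Pi_iff)
  qed (simp_all add: hom_one[OF h G.is_group H.is_group])
qed

lemma (in comm_group) finprod_subgroup_closed:
  assumes "subgroup K G" "f \<in> S \<rightarrow> K"
  shows "finprod G f S \<in> K"
  using assms(2)
proof (induction S rule: infinite_finite_induct)
  case (insert i S)
  then have "f \<in> S \<rightarrow> carrier G" "f i \<in> carrier G"
    using subgroup.subset[OF assms(1)] by blast+
  then show ?case
    using insert subgroup.m_closed[OF assms(1)] by simp
qed (simp_all add: subgroup.one_closed[OF assms(1)])

section \<open>Modules and homomorphisms\<close>

definition additive_group :: "('r, 'm) rmod \<Rightarrow> 'm monoid" where
  "additive_group M = \<lparr>carrier = mcarrier M, mult = madd M, one = mzero M\<rparr>"

lemma additive_group_simps [simp]: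
  "carrier (additive_group M) = mcarrier M"
  "mult (additive_group M) = madd M"
  "one (additive_group M) = mzero M"
  by (simp_all add: additive_group_def)

lemma right_module_iff_comm_group:
  "right_module M \<longleftrightarrow>
     comm_group (additive_group M) \<and>
     (\<forall>x\<in>mcarrier M. mneg M x = inv\<^bsub>additive_group M\<^esub> x) \<and>
     (\<forall>x\<in>mcarrier M. \<forall>r. msmult M x r \<in> mcarrier M) \<and>
     (\<forall>x\<in>mcarrier M. \<forall>y\<in>mcarrier M. \<forall>r.
        msmult M (madd M x y) r = madd M (msmult M x r) (msmult M y r)) \<and>
     (\<forall>x\<in>mcarrier M. \<forall>r s. msmult M x (r + s) = madd M (msmult M x r) (msmult M x s)) \<and>
     (\<forall>x\<in>mcarrier M. \<forall>r s. msmult M x (r * s) = msmult M (msmult M x r) s) \<and>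
     (\<forall>x\<in>mcarrier M. msmult M x 1 = x)"
  (is "_ \<longleftrightarrow> ?comm \<and> ?neg \<and> ?smult")
proof
  assume M: "right_module M"
  have comm: ?comm
  proof (rule comm_groupI)
    show "\<exists>y\<in>carrier (additive_group M). y \<otimes>\<^bsub>additive_group M\<^esub> x = \<one>\<^bsub>additive_group M\<^esub>"
      if "x \<in> carrier (additive_group M)" for x
      using M that unfolding right_module_def by auto
  qed (use M in \<open>auto simp: right_module_def\<close>)
  then interpret comm_group "additive_group M" .
  have ?neg
    using M by (auto simp: right_module_def intro!: inv_equality[symmetric])
  with comm M show "?comm \<and> ?neg \<and> ?smult"
    unfolding right_module_def by blast
next
  assume M: "?comm \<and> ?neg \<and> ?smult"
  then interpret comm_group "additive_group M" by blast
  show "right_module M"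
    unfolding right_module_def
    using M m_closed m_assoc m_comm l_one l_inv one_closed inv_closed by simp
qed

context
  fixes M :: "('r::ring_1, 'm) rmod"
  assumes M: "right_module M"
begin

lemma comm_group_additive_group: "comm_group (additive_group M)"
  using iffD1[OF right_module_iff_comm_group M] by (rule conjunct1)

lemma group_additive_group: "group (additive_group M)"
  using comm_group_additive_group by (rule comm_group.axioms(2))

interpretation comm_group "additive_group M"
  by (rule comm_group_additive_group)

lemmas mzero_closed = one_closed[simplified]
lemmas madd_closed = m_closed[simplified]
lemmas madd_assoc = m_assoc[simplified]
lemmas madd_commute = m_comm[simplified]
lemmas madd_left_commute = m_lcomm[simplified]
lemmas madd_zero_left = l_one[simplified]
lemmas madd_zero_right = r_one[simplified]

lemma mneg_eq_inv: "x \<in> mcarrier M \<Longrightarrow> mneg M x = inv\<^bsub>additive_group M\<^esub> x"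
  using iffD1[OF right_module_iff_comm_group M] by simp

lemma msmult_closed: "x \<in> mcarrier M \<Longrightarrow> msmult M x r \<in> mcarrier M"
  and msmult_madd:
    "x \<in> mcarrier M \<Longrightarrow> y \<in> mcarrier M \<Longrightarrow>
      msmult M (madd M x y) r = madd M (msmult M x r) (msmult M y r)"
  and msmult_add: "x \<in> mcarrier M \<Longrightarrow> msmult M x (r + s) = madd M (msmult M x r) (msmult M x s)"
  and msmult_mult: "x \<in> mcarrier M \<Longrightarrow> msmult M x (r * s) = msmult M (msmult M x r) s"
  and msmult_one: "x \<in> mcarrier M \<Longrightarrow> msmult M x 1 = x"
  using M unfolding right_module_def by blast+

lemma msmult_hom: "(\<lambda>x. msmult M x r) \<in> hom (additive_group M) (additive_group M)"
  by (rule homI) (simp_all add: msmult_closed msmult_madd)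

lemma msmult_mzero: "msmult M (mzero M) r = mzero M"
  using hom_one[OF msmult_hom is_group is_group] by simp

lemma msmult_mneg: "x \<in> mcarrier M \<Longrightarrow> msmult M (mneg M x) r = mneg M (msmult M x r)"
  using group_hom.hom_inv[of "additive_group M" "additive_group M" "\<lambda>x. msmult M x r" x]
  by (simp add: group_hom_def group_hom_axioms_def msmult_hom is_group mneg_eq_inv msmult_closed)

lemma msmult_zero: "x \<in> mcarrier M \<Longrightarrow> msmult M x 0 = mzero M"
  using r_cancel_one[of "msmult M x 0" "msmult M x 0"] msmult_add[of x 0 0] msmult_closed[of x 0]
  by simp

end

lemma rhomI:
  assumes "f \<in> mcarrier M \<rightarrow>\<^sub>E mcarrier N"
    and "\<And>x y. x \<in> mcarrier M \<Longrightarrow> y \<in> mcarrier M \<Longrightarrow> f (madd M x y) = madd N (f x) (f y)"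
    and "\<And>x r. x \<in> mcarrier M \<Longrightarrow> f (msmult M x r) = msmult N (f x) r"
  shows "f \<in> rhom M N"
  using assms unfolding rhom_def by blast

lemma
  assumes "f \<in> rhom M N"
  shows rhom_PiE: "f \<in> mcarrier M \<rightarrow>\<^sub>E mcarrier N"
    and rhom_closed: "x \<in> mcarrier M \<Longrightarrow> f x \<in> mcarrier N"
    and rhom_madd: "x \<in> mcarrier M \<Longrightarrow> y \<in> mcarrier M \<Longrightarrow> f (madd M x y) = madd N (f x) (f y)"
    and rhom_msmult: "x \<in> mcarrier M \<Longrightarrow> f (msmult M x r) = msmult N (f x) r"
  using assms unfolding rhom_def by auto

lemma rhom_eqI:
  assumes "f \<in> rhom M N" "g \<in> rhom M N" "\<And>x. x \<in> mcarrier M \<Longrightarrow> f x = g x"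
  shows "f = g"
  using assms(3) by (rule PiE_ext[OF rhom_PiE[OF assms(1)] rhom_PiE[OF assms(2)]])

lemma rhom_mzero:
  assumes "right_module M" "right_module N" "f \<in> rhom M N"
  shows "f (mzero M) = mzero N"
  using hom_one[of f "additive_group M" "additive_group N"] assms
  by (simp add: group_additive_group hom_def rhom_closed rhom_madd Pi_iff)

text \<open>Homomorphisms are extensional functions, so their composition has to mention the domain.\<close>
abbreviation comp_on ::
    "('n \<Rightarrow> 'k) \<Rightarrow> ('r, 'm) rmod \<Rightarrow> ('m \<Rightarrow> 'n) \<Rightarrow> 'm \<Rightarrow> 'k"  (\<open>(_ \<circ>\<^bsub>_\<^esub>/ _)\<close> [56, 0, 55] 55) where
  "g \<circ>\<^bsub>M\<^esub> f \<equiv> compose (mcarrier M) g f"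

abbreviation id_on :: "('r, 'm) rmod \<Rightarrow> 'm \<Rightarrow> 'm" where
  "id_on M \<equiv> \<lambda>x\<in>mcarrier M. x"

lemma rhom_id:
  assumes "right_module M"
  shows "id_on M \<in> rhom M M"
  using assms by (intro rhomI) (auto simp: madd_closed msmult_closed)

lemma rhom_compose:
  assumes "right_module M" "f \<in> rhom M N" "g \<in> rhom N K"
  shows "g \<circ>\<^bsub>M\<^esub> f \<in> rhom M K"
  using assms
  by (intro rhomI)
    (auto simp: compose_def madd_closed msmult_closed rhom_closed rhom_madd rhom_msmult)

lemma rhom_compose_assoc:
  assumes "f \<in> rhom M N"
  shows "h \<circ>\<^bsub>M\<^esub> g \<circ>\<^bsub>M\<^esub> f = (h \<circ>\<^bsub>N\<^esub> g) \<circ>\<^bsub>M\<^esub> f"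
  using rhom_closed[OF assms] by (intro compose_assoc) blast

lemma rhom_id_compose: "f \<in> rhom M N \<Longrightarrow> id_on N \<circ>\<^bsub>M\<^esub> f = f"
  by (rule Id_compose) (auto dest: rhom_PiE simp: PiE_iff)

lemma rhom_compose_id: "f \<in> rhom M N \<Longrightarrow> f \<circ>\<^bsub>M\<^esub> id_on M = f"
  by (rule compose_Id) (auto dest: rhom_PiE simp: PiE_iff)

lemma rmod_isoE:
  assumes M: "right_module M" and "rmod_iso M N"
  obtains f g where "f \<in> rhom M N" "g \<in> rhom N M" "g \<circ>\<^bsub>M\<^esub> f = id_on M" "f \<circ>\<^bsub>N\<^esub> g = id_on N"
proof -
  obtain f where f: "f \<in> rhom M N" and bij: "bij_betw f (mcarrier M) (mcarrier N)"
    using assms(2) unfolding rmod_iso_def by blast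
  define g where "g = (\<lambda>y\<in>mcarrier N. inv_into (mcarrier M) f y)"
  have fg: "f (g y) = y" and g_closed: "g y \<in> mcarrier M" if "y \<in> mcarrier N" for y
    using bij that by (auto simp: g_def bij_betw_def f_inv_into_f inv_into_into)
  have gf: "g (f x) = x" if "x \<in> mcarrier M" for x
    using bij that rhom_closed[OF f that] by (simp add: g_def bij_betw_inv_into_left)
  have "g \<in> rhom N M"
  proof (rule rhomI)
    show "g \<in> mcarrier N \<rightarrow>\<^sub>E mcarrier M"
      using g_closed by (auto simp: g_def)
    show "g (madd N x y) = madd M (g x) (g y)" if "x \<in> mcarrier N" "y \<in> mcarrier N" for x y
      using gf[of "madd M (g x) (g y)"] that
      by (simp add: madd_closed[OF M] rhom_madd[OF f] fg g_closed)
    show "g (msmult N x r) = msmult M (g x) r" if "x \<in> mcarrier N" for x r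
      using gf[of "msmult M (g x) r"] that
      by (simp add: msmult_closed[OF M] rhom_msmult[OF f] fg g_closed)
  qed
  then show thesis
    by (rule that[OF f]) (auto simp: compose_def fg gf intro!: restrict_ext)
qed

section \<open>Groups of homomorphisms and endomorphism rings\<close>

text \<open>Groups of HOL-Algebra are multiplicative, so sums of homomorphisms are written as products.\<close>
definition hom_group :: "('r::ring_1, 'm) rmod \<Rightarrow> ('r, 'n) rmod \<Rightarrow> ('m \<Rightarrow> 'n) monoid" where
  "hom_group M N = product_group (mcarrier M) (\<lambda>_. additive_group N)\<lparr>carrier := rhom M N\<rparr>"

lemma hom_group_simps [simp]:
  "carrier (hom_group M N) = rhom M N"
  "mult (hom_group M N) = hadd M N"
  "one (hom_group M N) = hzero M N"
  by (simp_all add: hom_group_def hadd_def hzero_def fun_eq_iff)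

context
  fixes M :: "('r::ring_1, 'm) rmod" and N :: "('r, 'n) rmod"
  assumes M: "right_module M" and N: "right_module N"
begin

lemma subgroup_rhom: "subgroup (rhom M N) (product_group (mcarrier M) (\<lambda>_. additive_group N))"
  (is "subgroup _ ?G")
proof (rule group.subgroupI)
  show "group ?G"
    by (simp add: group_additive_group[OF N])
  show "rhom M N \<subseteq> carrier ?G"
    unfolding rhom_def by auto
  have "hzero M N \<in> rhom M N"
    by (rule rhomI)
      (auto simp: hzero_def M N madd_closed msmult_closed mzero_closed madd_zero_left msmult_mzero)
  then show "rhom M N \<noteq> {}" by blast
  interpret comm_group "additive_group N"
    by (rule comm_group_additive_group[OF N])
  show "inv\<^bsub>?G\<^esub> f \<in> rhom M N" if f: "f \<in> rhom M N" for f
  proof -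
    have "inv\<^bsub>?G\<^esub> f = (\<lambda>x\<in>mcarrier M. inv\<^bsub>additive_group N\<^esub> f x)"
      using rhom_PiE[OF f] by (intro inv_product_group) (simp_all add: group_additive_group[OF N])
    also have "\<dots> \<in> rhom M N"
      using inv_mult[simplified] inv_closed[simplified] msmult_mneg[OF N]
      by (intro rhomI)
        (auto simp: M madd_closed msmult_closed rhom_closed[OF f] rhom_madd[OF f] rhom_msmult[OF f]
          mneg_eq_inv[OF N] msmult_closed[OF N])
    finally show ?thesis .
  qed
  show "f \<otimes>\<^bsub>?G\<^esub> g \<in> rhom M N" if f: "f \<in> rhom M N" and g: "g \<in> rhom M N" for f g
    by (rule rhomI)
      (auto simp: M madd_closed msmult_closed madd_closed[OF N] madd_assoc[OF N]
        madd_left_commute[OF N] msmult_madd[OF N] rhom_closed[OF f] rhom_closed[OF g]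
        rhom_madd[OF f] rhom_madd[OF g] rhom_msmult[OF f] rhom_msmult[OF g])
qed

lemma comm_group_hom_group: "comm_group (hom_group M N)"
proof (rule group.group_comm_groupI)
  show "group (hom_group M N)"
    unfolding hom_group_def
    by (rule group.subgroup_imp_group[OF _ subgroup_rhom]) (simp add: group_additive_group[OF N])
  show "f \<otimes>\<^bsub>hom_group M N\<^esub> g = g \<otimes>\<^bsub>hom_group M N\<^esub> f"
    if "f \<in> carrier (hom_group M N)" "g \<in> carrier (hom_group M N)" for f g
    using that by (simp add: hadd_def madd_commute[OF N] rhom_closed[of f M N] rhom_closed[of g M N]
        cong: restrict_cong)
qed

lemma inv_hom_group:
  assumes f: "f \<in> rhom M N"
  shows "inv\<^bsub>hom_group M N\<^esub> f = hneg M N f"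
proof -
  have "inv\<^bsub>hom_group M N\<^esub> f = inv\<^bsub>product_group (mcarrier M) (\<lambda>_. additive_group N)\<^esub> f"
    unfolding hom_group_def
    by (rule group.m_inv_consistent[OF _ subgroup_rhom f]) (simp add: group_additive_group[OF N])
  also have "\<dots> = (\<lambda>x\<in>mcarrier M. inv\<^bsub>additive_group N\<^esub> f x)"
    using rhom_PiE[OF f] by (intro inv_product_group) (simp_all add: group_additive_group[OF N])
  also have "\<dots> = hneg M N f"
    unfolding hneg_def by (rule restrict_ext) (simp add: mneg_eq_inv[OF N] rhom_closed[OF f])
  finally show ?thesis .
qed

lemma hom_subgroup_iff_subgroup: "hom_subgroup M N S \<longleftrightarrow> subgroup S (hom_group M N)"
proof -
  interpret comm_group "hom_group M N"
    by (rule comm_group_hom_group)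
  have "inv\<^bsub>hom_group M N\<^esub> f = hneg M N f" if "f \<in> S" "S \<subseteq> rhom M N" for f
    using that inv_hom_group by blast
  then show ?thesis
    by (auto simp: hom_subgroup_def subgroup_def)
qed

lemma hzero_rhom: "hzero M N \<in> rhom M N"
  using subgroup.one_closed[OF subgroup_rhom] by (simp add: hzero_def)

end

lemma compose_left_hom:
  assumes "right_module M" and g: "g \<in> rhom N K"
  shows "(\<lambda>f. g \<circ>\<^bsub>M\<^esub> f) \<in> hom (hom_group M N) (hom_group M K)"
proof (rule homI)
  show "g \<circ>\<^bsub>M\<^esub> f \<in> carrier (hom_group M K)" if "f \<in> carrier (hom_group M N)" for f
    using assms that rhom_compose by simp
qed (auto simp: hadd_def compose_def rhom_madd[OF g] rhom_closed intro!: restrict_ext)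

lemma compose_right_hom:
  assumes "right_module M" and f: "f \<in> rhom M N"
  shows "(\<lambda>g. g \<circ>\<^bsub>M\<^esub> f) \<in> hom (hom_group N K) (hom_group M K)"
proof (rule homI)
  show "g \<circ>\<^bsub>M\<^esub> f \<in> carrier (hom_group M K)" if "g \<in> carrier (hom_group N K)" for g
    using assms that rhom_compose by simp
qed (auto simp: hadd_def compose_def rhom_closed[OF f] intro!: restrict_ext)

lemma sum_rhom:
  assumes "right_module M" "right_module N" "\<And>i. i \<in> F \<Longrightarrow> f i \<in> rhom M N"
  shows "(\<Otimes>\<^bsub>hom_group M N\<^esub>i\<in>F. f i) \<in> rhom M N"
proof -
  interpret comm_group "hom_group M N"
    using assms(1,2) by (rule comm_group_hom_group)
  show ?thesis using finprod_closed[of f F] assms(3) by auto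
qed

lemma sum_rhom_cong:
  assumes "right_module M" "right_module N" "\<And>i. i \<in> F \<Longrightarrow> g i \<in> rhom M N"
    and "\<And>i. i \<in> F \<Longrightarrow> f i = g i"
  shows "(\<Otimes>\<^bsub>hom_group M N\<^esub>i\<in>F. f i) = (\<Otimes>\<^bsub>hom_group M N\<^esub>i\<in>F. g i)"
  using assms comm_group_hom_group[OF assms(1,2)]
  by (intro comm_monoid.finprod_cong') (auto simp: comm_group.axioms(1))

lemma compose_sum:
  assumes "right_module M" "right_module N" "right_module K" "g \<in> rhom N K"
    and "\<And>i. i \<in> F \<Longrightarrow> f i \<in> rhom M N"
  shows "g \<circ>\<^bsub>M\<^esub> (\<Otimes>\<^bsub>hom_group M N\<^esub>i\<in>F. f i) = (\<Otimes>\<^bsub>hom_group M K\<^esub>i\<in>F. g \<circ>\<^bsub>M\<^esub> f i)"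
  using assms
  by (intro hom_finprod[where h = "\<lambda>f. g \<circ>\<^bsub>M\<^esub> f"] comm_group_hom_group compose_left_hom) auto

lemma sum_compose:
  assumes "right_module M" "right_module N" "right_module K" "f \<in> rhom M N"
    and "\<And>i. i \<in> F \<Longrightarrow> g i \<in> rhom N K"
  shows "(\<Otimes>\<^bsub>hom_group N K\<^esub>i\<in>F. g i) \<circ>\<^bsub>M\<^esub> f = (\<Otimes>\<^bsub>hom_group M K\<^esub>i\<in>F. g i \<circ>\<^bsub>M\<^esub> f)"
  using assms
  by (intro hom_finprod[where h = "\<lambda>g. g \<circ>\<^bsub>M\<^esub> f"] comm_group_hom_group compose_right_hom) auto

definition end_ring :: "('r::ring_1, 'm) rmod \<Rightarrow> ('m \<Rightarrow> 'm) ring" where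
  "end_ring M = \<lparr>carrier = rhom M M, mult = \<lambda>g f. g \<circ>\<^bsub>M\<^esub> f, one = id_on M,
     zero = hzero M M, add = hadd M M\<rparr>"

lemma end_ring_simps [simp]:
  "carrier (end_ring M) = rhom M M"
  "mult (end_ring M) g f = g \<circ>\<^bsub>M\<^esub> f"
  "one (end_ring M) = id_on M"
  by (simp_all add: end_ring_def)

lemma add_monoid_end_ring: "add_monoid (end_ring M) = hom_group M M"
  by (rule monoid.equality) (simp_all add: end_ring_def)

lemma ring_end_ring:
  assumes M: "right_module M"
  shows "ring (end_ring M)"
proof (rule ringI)
  show "abelian_group (end_ring M)"
    using comm_group_hom_group[OF M M]
    by (intro comm_group_abelian_groupI) (simp only: add_monoid_end_ring)
  show "monoid (end_ring M)"
    by (rule monoidI)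
      (simp_all add: M rhom_compose rhom_id rhom_compose_assoc rhom_id_compose rhom_compose_id)
  show "(f \<oplus>\<^bsub>end_ring M\<^esub> g) \<otimes>\<^bsub>end_ring M\<^esub> h = f \<otimes>\<^bsub>end_ring M\<^esub> h \<oplus>\<^bsub>end_ring M\<^esub> g \<otimes>\<^bsub>end_ring M\<^esub> h"
    if "f \<in> carrier (end_ring M)" "g \<in> carrier (end_ring M)" "h \<in> carrier (end_ring M)" for f g h
    using hom_mult[OF compose_right_hom[OF M, of h M M]] that by (simp add: end_ring_def)
  show "h \<otimes>\<^bsub>end_ring M\<^esub> (f \<oplus>\<^bsub>end_ring M\<^esub> g) = h \<otimes>\<^bsub>end_ring M\<^esub> f \<oplus>\<^bsub>end_ring M\<^esub> h \<otimes>\<^bsub>end_ring M\<^esub> g"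
    if "f \<in> carrier (end_ring M)" "g \<in> carrier (end_ring M)" "h \<in> carrier (end_ring M)" for f g h
    using hom_mult[OF compose_left_hom[OF M, of h M M]] that by (simp add: end_ring_def)
qed

lemma finsum_end_ring: "finsum (end_ring M) f F = finprod (hom_group M M) f F"
  by (simp only: finsum_def add_monoid_end_ring)

lemma end_right_ideal_iff:
  assumes M: "right_module M"
  shows "end_right_ideal M S \<longleftrightarrow> additive_subgroup S (end_ring M) \<and>
    (\<forall>f\<in>S. \<forall>h\<in>carrier (end_ring M). f \<otimes>\<^bsub>end_ring M\<^esub> h \<in> S)"
  unfolding end_right_ideal_def hom_subgroup_iff_subgroup[OF M M] additive_subgroup_def
    add_monoid_end_ring by simp

lemma end_right_ideal_add_principal:
  assumes M: "right_module M" and S: "end_right_ideal M S" and k: "k \<in> rhom M M"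
  shows "end_right_ideal M (S <+>\<^bsub>end_ring M\<^esub> (\<lambda>s. k \<otimes>\<^bsub>end_ring M\<^esub> s) ` carrier (end_ring M))"
    (is "end_right_ideal M (S <+>\<^bsub>?E\<^esub> ?K)")
proof -
  interpret ring ?E by (rule ring_end_ring[OF M])
  have kE: "k \<in> carrier ?E" using k by simp
  have S_carrier: "S \<subseteq> carrier ?E"
    using S by (auto simp: end_right_ideal_def hom_subgroup_def)
  have "group_hom (add_monoid ?E) (add_monoid ?E) (\<lambda>s. k \<otimes>\<^bsub>?E\<^esub> s)"
    using kE
    by (intro group_hom.intro group_hom_axioms.intro a_group homI)
      (simp_all add: r_distr del: end_ring_simps)
  from group_hom.img_is_subgroup[OF this] have "additive_subgroup ?K ?E"
    by (simp add: additive_subgroup_def)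
  then have "additive_subgroup (S <+>\<^bsub>?E\<^esub> ?K) ?E"
    using S end_right_ideal_iff[OF M] add_additive_subgroups by blast
  moreover have "x \<otimes>\<^bsub>?E\<^esub> h \<in> S <+>\<^bsub>?E\<^esub> ?K" if x: "x \<in> S <+>\<^bsub>?E\<^esub> ?K" and h: "h \<in> carrier ?E" for x h
  proof -
    obtain p s where p: "p \<in> S" and s: "s \<in> carrier ?E" and x_eq: "x = p \<oplus>\<^bsub>?E\<^esub> k \<otimes>\<^bsub>?E\<^esub> s"
      using x by (auto simp: set_add_def')
    have "x \<otimes>\<^bsub>?E\<^esub> h = p \<otimes>\<^bsub>?E\<^esub> h \<oplus>\<^bsub>?E\<^esub> k \<otimes>\<^bsub>?E\<^esub> (s \<otimes>\<^bsub>?E\<^esub> h)"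
      using p S_carrier s h kE x_eq by (simp add: l_distr m_assoc subset_iff del: end_ring_simps)
    moreover have "p \<otimes>\<^bsub>?E\<^esub> h \<in> S" "s \<otimes>\<^bsub>?E\<^esub> h \<in> carrier ?E"
      using S p s h end_right_ideal_iff[OF M] by blast+
    ultimately show ?thesis by (auto simp: set_add_def')
  qed
  ultimately show ?thesis by (simp only: end_right_ideal_iff[OF M]) blast
qed

section \<open>Homogeneous linear systems over division rings\<close>

lemma (in abelian_monoid) finsum_remove:
  assumes "finite F" "i \<in> F" "f \<in> F \<rightarrow> carrier G"
  shows "(\<Oplus>k\<in>F. f k) = f i \<oplus> (\<Oplus>k\<in>F - {i}. f k)"
  using finsum_insert[of "F - {i}" i f] assms by (auto simp: insert_absorb Pi_iff)

lemma (in ring) finsum_substitute: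
  assumes "finite F" "i \<in> F" and r: "\<And>k. k \<in> F \<Longrightarrow> r k \<in> carrier R"
    and c: "\<And>k. k \<in> F - {i} \<Longrightarrow> c k \<in> carrier R"
    and x: "\<And>k. k \<in> F - {i} \<Longrightarrow> x k \<in> carrier R"
  shows "(\<Oplus>k\<in>F. r k \<otimes> (x(i := \<ominus> (\<Oplus>k\<in>F - {i}. c k \<otimes> x k))) k) =
    (\<Oplus>k\<in>F - {i}. (r k \<ominus> r i \<otimes> c k) \<otimes> x k)" (is "(\<Oplus>k\<in>F. r k \<otimes> ?y k) = ?t")
proof -
  define s where "s = (\<Oplus>k\<in>F - {i}. c k \<otimes> x k)"
  note ri = r[OF \<open>i \<in> F\<close>]
  have s: "s \<in> carrier R" and t: "?t \<in> carrier R"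
    using r x c ri by (auto simp: s_def intro!: finsum_closed)
  have y: "?y k \<in> carrier R" if "k \<in> F" for k
    using that s x by (simp add: s_def)
  have "(\<Oplus>k\<in>F - {i}. r k \<otimes> ?y k) =
      (\<Oplus>k\<in>F - {i}. (r k \<ominus> r i \<otimes> c k) \<otimes> x k \<oplus> r i \<otimes> (c k \<otimes> x k))"
    using r x c ri
    by (intro finsum_cong') (auto simp: a_minus_def l_distr m_assoc l_minus a_assoc l_neg)
  also have "\<dots> = ?t \<oplus> (\<Oplus>k\<in>F - {i}. r i \<otimes> (c k \<otimes> x k))"
    using r x c ri by (intro finsum_addf) auto
  also have "(\<Oplus>k\<in>F - {i}. r i \<otimes> (c k \<otimes> x k)) = r i \<otimes> s"
    unfolding s_def using \<open>finite F\<close> x c ri by (intro finsum_rdistr[symmetric]) auto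
  finally have "(\<Oplus>k\<in>F. r k \<otimes> ?y k) = r i \<otimes> ?y i \<oplus> (?t \<oplus> r i \<otimes> s)"
    using finsum_remove[of F i "\<lambda>k. r k \<otimes> ?y k"] assms(1,2) r y by auto
  also have "\<dots> = ?t"
    using s t ri by (simp add: s_def[symmetric] r_minus a_lcomm[of "\<ominus> (r i \<otimes> s)"] l_neg)
  finally show ?thesis .
qed

lemma (in ring) homogeneous_system_eliminate:
  fixes a :: "'j \<Rightarrow> 'i \<Rightarrow> 'a"
  assumes "finite F" and p: "p \<in> F"
    and a: "\<And>k i. k \<in> insert j G \<Longrightarrow> i \<in> F \<Longrightarrow> a k i \<in> carrier R"
    and b: "b \<in> carrier R" "a j p \<otimes> b = \<one>"
    and reduced: "\<exists>y\<in>F - {p} \<rightarrow> carrier R. (\<exists>i\<in>F - {p}. y i \<noteq> \<zero>) \<and>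
      (\<forall>k\<in>G. (\<Oplus>i\<in>F - {p}. (a k i \<ominus> a k p \<otimes> (b \<otimes> a j i)) \<otimes> y i) = \<zero>)"
  shows "\<exists>x\<in>F \<rightarrow> carrier R. (\<exists>i\<in>F. x i \<noteq> \<zero>) \<and> (\<forall>k\<in>insert j G. (\<Oplus>i\<in>F. a k i \<otimes> x i) = \<zero>)"
proof -
  obtain y where y: "\<And>i. i \<in> F - {p} \<Longrightarrow> y i \<in> carrier R" "\<exists>i\<in>F - {p}. y i \<noteq> \<zero>"
    and G: "\<And>k. k \<in> G \<Longrightarrow> (\<Oplus>i\<in>F - {p}. (a k i \<ominus> a k p \<otimes> (b \<otimes> a j i)) \<otimes> y i) = \<zero>"
    using reduced by blast
  define x where "x = y(p := \<ominus> (\<Oplus>i\<in>F - {p}. b \<otimes> a j i \<otimes> y i))"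
  have "(\<Oplus>i\<in>F - {p}. (a j i \<ominus> a j p \<otimes> (b \<otimes> a j i)) \<otimes> y i) = \<zero>"
  proof (rule add.finprod_one_eqI)
    fix i assume "i \<in> F - {p}"
    then show "(a j i \<ominus> a j p \<otimes> (b \<otimes> a j i)) \<otimes> y i = \<zero>"
      using p a b y(1) by (simp add: m_assoc[symmetric] a_minus_def r_neg)
  qed
  then have "(\<Oplus>i\<in>F. a k i \<otimes> x i) = \<zero>" if "k \<in> insert j G" for k
    unfolding x_def using that G assms(1) p a b(1) y(1) by (subst finsum_substitute) auto
  moreover have "x \<in> F \<rightarrow> carrier R"
    using y(1) a b(1) by (auto simp: x_def intro!: a_inv_closed finsum_closed)
  moreover have "\<exists>i\<in>F. x i \<noteq> \<zero>"
    using y(2) by (auto simp: x_def)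
  ultimately show ?thesis by blast
qed

lemma (in ring) homogeneous_system_nontrivial_solution:
  fixes a :: "'j \<Rightarrow> 'i \<Rightarrow> 'a"
  assumes right_inverse: "\<And>x. x \<in> carrier R \<Longrightarrow> x \<noteq> \<zero> \<Longrightarrow> \<exists>y\<in>carrier R. x \<otimes> y = \<one>"
    and nontrivial: "\<one> \<noteq> \<zero>"
    and "finite G" "finite F" "card G < card F"
    and "\<And>j i. j \<in> G \<Longrightarrow> i \<in> F \<Longrightarrow> a j i \<in> carrier R"
  shows "\<exists>x\<in>F \<rightarrow> carrier R. (\<exists>i\<in>F. x i \<noteq> \<zero>) \<and> (\<forall>j\<in>G. (\<Oplus>i\<in>F. a j i \<otimes> x i) = \<zero>)"
  using assms(3-)
proof (induction G arbitrary: F a)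
  case empty
  then have "F \<noteq> {}" by auto
  then show ?case
    using nontrivial by (intro bexI[of _ "\<lambda>_. \<one>"]) auto
next
  case (insert j G)
  show ?case
  proof (cases "\<forall>i\<in>F. a j i = \<zero>")
    case True
    have "card G < card F" using insert.prems insert.hyps by simp
    then obtain x where x: "x \<in> F \<rightarrow> carrier R" "\<exists>i\<in>F. x i \<noteq> \<zero>"
      and G: "\<forall>k\<in>G. (\<Oplus>i\<in>F. a k i \<otimes> x i) = \<zero>"
      using insert.IH[of F a] insert.prems by blast
    moreover have "(\<Oplus>i\<in>F. a j i \<otimes> x i) = \<zero>"
      using True x(1) by (intro add.finprod_one_eqI) (auto simp: Pi_iff)
    ultimately show ?thesis by blast
  next
    case False
    then obtain p where p: "p \<in> F" "a j p \<noteq> \<zero>" by blast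
    then obtain b where b: "b \<in> carrier R" "a j p \<otimes> b = \<one>"
      using right_inverse insert.prems(3) by blast
    have "card G < card (F - {p})"
      using insert.prems(1,2) insert.hyps p(1) by (simp add: card_Diff_singleton)
    then show ?thesis
      using p(1) b insert.prems
      by (intro homogeneous_system_eliminate[where p = p and b = b] insert.IH) auto
  qed
qed

lemma (in ideal) rcos_eq_zero_iff:
  assumes "x \<in> carrier R"
  shows "I +> x = \<zero>\<^bsub>R Quot I\<^esub> \<longleftrightarrow> x \<in> I"
proof -
  interpret quotient: ring_hom_ring R "R Quot I" "(+>) I"
    by (rule rcos_ring_hom_ring)
  show ?thesis
    using quotient_eq_iff_same_a_r_cos[OF is_ideal assms zero_closed] assms quotient.hom_zero
    by (simp add: a_minus_def)
qed

lemma (in ideal) quotient_surj: "X \<in> carrier (R Quot I) \<Longrightarrow> \<exists>x\<in>carrier R. X = I +> x"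
  unfolding FactRing_def A_RCOSETS_def' partial_object.select_convs by blast

lemma (in ideal) quotient_right_inverse:
  assumes right_inverse: "\<And>x. x \<in> carrier R \<Longrightarrow> x \<notin> I \<Longrightarrow> \<exists>y\<in>carrier R. x \<otimes> y \<ominus> \<one> \<in> I"
    and X: "X \<in> carrier (R Quot I)" "X \<noteq> \<zero>\<^bsub>R Quot I\<^esub>"
  shows "\<exists>Y\<in>carrier (R Quot I). X \<otimes>\<^bsub>R Quot I\<^esub> Y = \<one>\<^bsub>R Quot I\<^esub>"
proof -
  interpret quotient: ring_hom_ring R "R Quot I" "(+>) I"
    by (rule rcos_ring_hom_ring)
  obtain x where x: "x \<in> carrier R" "X = I +> x" "x \<notin> I"
    using X quotient_surj rcos_eq_zero_iff by metis
  then obtain y where y: "y \<in> carrier R" "x \<otimes> y \<ominus> \<one> \<in> I"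
    using right_inverse by blast
  then have "X \<otimes>\<^bsub>R Quot I\<^esub> (I +> y) = \<one>\<^bsub>R Quot I\<^esub>"
    using x quotient_eq_iff_same_a_r_cos[OF is_ideal, of "x \<otimes> y" \<one>]
      quotient.hom_mult[of x y] quotient.hom_one by simp
  then show ?thesis
    using quotient.hom_closed[OF y(1)] by blast
qed

lemma (in ideal) homogeneous_system_nontrivial_solution_mod:
  fixes a :: "'j \<Rightarrow> 'i \<Rightarrow> 'a"
  assumes right_inverse: "\<And>x. x \<in> carrier R \<Longrightarrow> x \<notin> I \<Longrightarrow> \<exists>y\<in>carrier R. x \<otimes> y \<ominus> \<one> \<in> I"
    and proper: "I \<noteq> carrier R"
    and "finite G" "finite F" "card G < card F"
    and a: "\<And>j i. j \<in> G \<Longrightarrow> i \<in> F \<Longrightarrow> a j i \<in> carrier R"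
  shows "\<exists>x\<in>F \<rightarrow> carrier R. (\<exists>i\<in>F. x i \<notin> I) \<and> (\<forall>j\<in>G. (\<Oplus>i\<in>F. a j i \<otimes> x i) \<in> I)"
proof -
  interpret quotient: ring_hom_ring R "R Quot I" "(+>) I"
    by (rule rcos_ring_hom_ring)
  have "\<one>\<^bsub>R Quot I\<^esub> \<noteq> \<zero>\<^bsub>R Quot I\<^esub>"
    using proper one_imp_carrier rcos_eq_zero_iff[of \<one>] quotient.hom_one by auto
  then have "\<exists>d\<in>F \<rightarrow> carrier (R Quot I). (\<exists>i\<in>F. d i \<noteq> \<zero>\<^bsub>R Quot I\<^esub>) \<and>
    (\<forall>j\<in>G. (\<Oplus>\<^bsub>R Quot I\<^esub>i\<in>F. (I +> a j i) \<otimes>\<^bsub>R Quot I\<^esub> d i) = \<zero>\<^bsub>R Quot I\<^esub>)"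
    using quotient_right_inverse[OF right_inverse] assms(3-)
    by (intro quotient.S.homogeneous_system_nontrivial_solution) auto
  then obtain d where d: "\<And>i. i \<in> F \<Longrightarrow> d i \<in> carrier (R Quot I)" "\<exists>i\<in>F. d i \<noteq> \<zero>\<^bsub>R Quot I\<^esub>"
    and system: "\<And>j. j \<in> G \<Longrightarrow> (\<Oplus>\<^bsub>R Quot I\<^esub>i\<in>F. (I +> a j i) \<otimes>\<^bsub>R Quot I\<^esub> d i) = \<zero>\<^bsub>R Quot I\<^esub>"
    by blast
  obtain x where x: "\<And>i. i \<in> F \<Longrightarrow> x i \<in> carrier R" "\<And>i. i \<in> F \<Longrightarrow> d i = I +> x i"
    using quotient_surj[OF d(1)] by metis
  have "(\<Oplus>i\<in>F. a j i \<otimes> x i) \<in> I" if j: "j \<in> G" for j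
  proof -
    have "I +> (\<Oplus>i\<in>F. a j i \<otimes> x i) = finsum (R Quot I) ((+>) I \<circ> (\<lambda>i. a j i \<otimes> x i)) F"
      using a[OF j] x(1) by (intro quotient.hom_finsum) auto
    also have "\<dots> = (\<Oplus>\<^bsub>R Quot I\<^esub>i\<in>F. (I +> a j i) \<otimes>\<^bsub>R Quot I\<^esub> d i)"
      using a[OF j] x d(1) by (intro quotient.S.finsum_cong') simp_all
    also note system[OF j]
    finally show ?thesis
      using a[OF j] x(1) by (intro rcos_eq_zero_iff[THEN iffD1] finsum_closed) auto
  qed
  moreover have "\<exists>i\<in>F. x i \<notin> I"
    using d(2) x rcos_eq_zero_iff by auto
  ultimately show ?thesis using x(1) by blast
qed

section \<open>Measurable cardinals and sigma-ideals\<close>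

definition sigma_ideal :: "'a set set \<Rightarrow> bool" where
  "sigma_ideal N \<longleftrightarrow> {} \<in> N \<and> (\<forall>X\<in>N. \<forall>Y\<subseteq>X. Y \<in> N) \<and>
     (\<forall>X :: nat \<Rightarrow> 'a set. range X \<subseteq> N \<longrightarrow> (\<Union>n. X n) \<in> N)"

lemma
  assumes "sigma_ideal N"
  shows sigma_ideal_empty: "{} \<in> N"
    and sigma_ideal_subset: "X \<in> N \<Longrightarrow> Y \<subseteq> X \<Longrightarrow> Y \<in> N"
    and sigma_ideal_UN: "(\<And>n::nat. X' n \<in> N) \<Longrightarrow> (\<Union>n. X' n) \<in> N"
  using assms unfolding sigma_ideal_def by blast+

lemma sigma_ideal_Un:
  assumes N: "sigma_ideal N" and "X \<in> N" "Y \<in> N"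
  shows "X \<union> Y \<in> N"
proof -
  have "X \<union> Y = (\<Union>n::nat. if n = 0 then X else Y)" by auto
  then show ?thesis using sigma_ideal_UN[OF N, of "\<lambda>n. if n = 0 then X else Y"] assms(2,3) by simp
qed

lemma measurable_card_if_sigma_ideal_atom:
  assumes N: "sigma_ideal N" and singletons: "\<And>x. x \<in> I \<Longrightarrow> {x} \<in> N"
    and "X \<subseteq> I" "X \<notin> N" and atom: "\<And>Y. Y \<subseteq> X \<Longrightarrow> Y \<in> N \<or> X - Y \<in> N"
  shows "measurable_card I"
proof -
  define U where "U = {Y. Y \<subseteq> I \<and> X - Y \<in> N}"
  show ?thesis
    unfolding measurable_card_def
  proof (intro exI[of _ U] conjI ballI allI impI)
    show "I \<in> U"
      using \<open>X \<subseteq> I\<close> sigma_ideal_empty[OF N] by (simp add: U_def Diff_eq_empty_iff[THEN iffD2])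
    show "{} \<notin> U" using \<open>X \<notin> N\<close> by (simp add: U_def)
    show "Y' \<in> U" if "Y \<in> U" "Y \<subseteq> Y' \<and> Y' \<subseteq> I" for Y Y'
      using that sigma_ideal_subset[OF N, of "X - Y" "X - Y'"] unfolding U_def by blast
    show "Y \<in> U \<or> I - Y \<in> U" if "Y \<subseteq> I" for Y
    proof -
      have "X - (I - Y) = X \<inter> Y" "X - X \<inter> Y = X - Y" using \<open>X \<subseteq> I\<close> by auto
      then show ?thesis using atom[of "X \<inter> Y"] that unfolding U_def by auto
    qed
    show "(\<Inter>n. F n) \<in> U" if "\<forall>n::nat. F n \<in> U" for F
    proof -
      have "X - (\<Inter>n. F n) = (\<Union>n. X - F n)" by auto
      then show ?thesis using sigma_ideal_UN[OF N, of "\<lambda>n. X - F n"] that unfolding U_def by auto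
    qed
    show "{x} \<notin> U" if "x \<in> I" for x
      using sigma_ideal_Un[OF N singletons[OF that], of "X - {x}"]
        sigma_ideal_subset[OF N, of "{x} \<union> (X - {x})" X] \<open>X \<notin> N\<close>
      unfolding U_def by blast
  qed (auto simp: U_def)
qed

lemma atom_if_no_disjoint_sequence:
  assumes "X\<^sub>0 \<notin> N"
    and disjoint: "\<And>Z :: nat \<Rightarrow> 'a set. disjoint_family Z \<Longrightarrow> \<exists>n. Z n \<in> N"
  shows "\<exists>X\<subseteq>X\<^sub>0. X \<notin> N \<and> (\<forall>Y\<subseteq>X. Y \<in> N \<or> X - Y \<in> N)"
proof (rule ccontr)
  assume "\<not> ?thesis"
  then have "\<exists>Y\<subseteq>X. Y \<notin> N \<and> X - Y \<notin> N" if "X \<subseteq> X\<^sub>0" "X \<notin> N" for X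
    using that by blast
  then obtain s where s: "\<And>X. X \<subseteq> X\<^sub>0 \<Longrightarrow> X \<notin> N \<Longrightarrow> s X \<subseteq> X \<and> s X \<notin> N \<and> X - s X \<notin> N"
    by metis
  define X where "X = (\<lambda>n. (s ^^ n) X\<^sub>0)"
  have X_Suc: "X (Suc n) = s (X n)" for n by (simp add: X_def)
  have X: "X n \<subseteq> X\<^sub>0 \<and> X n \<notin> N" for n
  proof (induction n)
    case (Suc n)
    then show ?case using s[of "X n"] by (auto simp: X_Suc)
  qed (simp add: X_def \<open>X\<^sub>0 \<notin> N\<close>)
  have X_antimono: "X n \<subseteq> X m" if "m \<le> n" for m n
    using that by (rule lift_Suc_antimono_le[rotated]) (use X s X_Suc in auto)
  have "disjoint_family (\<lambda>n. X n - X (Suc n))"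
    unfolding disjoint_family_on_def
  proof (intro ballI impI)
    fix m n :: nat assume "m \<noteq> n"
    then have "Suc m \<le> n \<or> Suc n \<le> m" by linarith
    then show "(X m - X (Suc m)) \<inter> (X n - X (Suc n)) = {}"
      using X_antimono by blast
  qed
  then obtain n where "X n - X (Suc n) \<in> N" using disjoint by blast
  then show False using s X X_Suc by metis
qed

lemma nonmeasurable_in_sigma_ideal:
  assumes "\<not> measurable_card I" "sigma_ideal N" "\<And>x. x \<in> I \<Longrightarrow> {x} \<in> N"
    and "\<And>Z :: nat \<Rightarrow> 'a set. disjoint_family Z \<Longrightarrow> \<exists>n. Z n \<in> N"
  shows "I \<in> N"
proof (rule ccontr)
  assume "I \<notin> N"
  then obtain X where "X \<subseteq> I" "X \<notin> N" "\<And>Y. Y \<subseteq> X \<Longrightarrow> Y \<in> N \<or> X - Y \<in> N"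
    using atom_if_no_disjoint_sequence[OF _ assms(4)] by metis
  then show False using measurable_card_if_sigma_ideal_atom assms(1-3) by blast
qed

section \<open>Products\<close>

lemma rprod_simps:
  "mcarrier (rprod I A) = (\<Pi>\<^sub>E i\<in>I. mcarrier (A i))"
  "madd (rprod I A) x y = (\<lambda>i\<in>I. madd (A i) (x i) (y i))"
  "mzero (rprod I A) = (\<lambda>i\<in>I. mzero (A i))"
  "mneg (rprod I A) x = (\<lambda>i\<in>I. mneg (A i) (x i))"
  "msmult (rprod I A) x r = (\<lambda>i\<in>I. msmult (A i) (x i) r)"
  by (simp_all add: rprod_def)

lemma additive_group_rprod:
  "additive_group (rprod I A) = product_group I (\<lambda>i. additive_group (A i))"
  by (rule monoid.equality) (simp_all add: rprod_simps fun_eq_iff)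

lemma right_module_rprod:
  assumes A: "\<And>i. i \<in> I \<Longrightarrow> right_module (A i)"
  shows "right_module (rprod I A)"
  unfolding right_module_iff_comm_group
proof (intro conjI ballI allI)
  let ?G = "\<lambda>i. additive_group (A i)"
  show "comm_group (additive_group (rprod I A))"
    unfolding additive_group_rprod
  proof (rule group.group_comm_groupI)
    show "group (product_group I ?G)"
      by (simp add: A group_additive_group)
    show "x \<otimes>\<^bsub>product_group I ?G\<^esub> y = y \<otimes>\<^bsub>product_group I ?G\<^esub> x"
      if "x \<in> carrier (product_group I ?G)" "y \<in> carrier (product_group I ?G)" for x y
      using that A by (auto simp: rprod_simps PiE_iff madd_commute cong: restrict_cong)
  qed
  fix x assume x: "x \<in> mcarrier (rprod I A)"
  show "mneg (rprod I A) x = inv\<^bsub>additive_group (rprod I A)\<^esub> x"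
    using x A
    by (auto simp: additive_group_rprod group_additive_group mneg_eq_inv rprod_simps PiE_iff
        cong: restrict_cong)
  show "msmult (rprod I A) x r \<in> mcarrier (rprod I A)" for r
    using x A by (auto simp: rprod_simps PiE_iff msmult_closed)
  show "msmult (rprod I A) (madd (rprod I A) x y) r =
      madd (rprod I A) (msmult (rprod I A) x r) (msmult (rprod I A) y r)"
    if "y \<in> mcarrier (rprod I A)" for y r
    using x that A by (auto simp: rprod_simps PiE_iff msmult_madd intro!: restrict_ext)
  show "msmult (rprod I A) x (r + s) =
      madd (rprod I A) (msmult (rprod I A) x r) (msmult (rprod I A) x s)"
    and "msmult (rprod I A) x (r * s) = msmult (rprod I A) (msmult (rprod I A) x r) s" for r s
    using x A by (auto simp: rprod_simps PiE_iff msmult_add msmult_mult intro!: restrict_ext)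
  show "msmult (rprod I A) x 1 = x"
    using x A
    by (intro PiE_ext[of _ I "\<lambda>i. mcarrier (A i)"]) (auto simp: rprod_simps PiE_iff msmult_one)
qed

definition rprod_proj :: "'i set \<Rightarrow> ('i \<Rightarrow> ('r, 'm) rmod) \<Rightarrow> 'i \<Rightarrow> ('i \<Rightarrow> 'm) \<Rightarrow> 'm" where
  "rprod_proj I A i = (\<lambda>x\<in>mcarrier (rprod I A). x i)"

definition rprod_inj :: "'i set \<Rightarrow> ('i \<Rightarrow> ('r, 'm) rmod) \<Rightarrow> 'i \<Rightarrow> 'm \<Rightarrow> 'i \<Rightarrow> 'm" where
  "rprod_inj I A i = (\<lambda>y\<in>mcarrier (A i). \<lambda>k\<in>I. if k = i then y else mzero (A k))"

definition rprod_cut :: "'i set \<Rightarrow> ('i \<Rightarrow> ('r, 'm) rmod) \<Rightarrow> 'i set \<Rightarrow> ('i \<Rightarrow> 'm) \<Rightarrow> 'i \<Rightarrow> 'm" where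
  "rprod_cut I A S x = (\<lambda>i\<in>I. if i \<in> S then x i else mzero (A i))"

lemma rprod_cut_empty: "rprod_cut I A {} x = mzero (rprod I A)"
  by (simp add: rprod_cut_def rprod_simps)

lemma rprod_cut_rprod_cut: "rprod_cut I A S (rprod_cut I A T x) = rprod_cut I A (S \<inter> T) x"
  by (auto simp: rprod_cut_def)

lemma rprod_cut_all: "x \<in> mcarrier (rprod I A) \<Longrightarrow> rprod_cut I A I x = x"
  by (auto simp: rprod_cut_def rprod_simps PiE_iff extensional_def)

lemma rprod_cut_singleton:
  assumes "i \<in> I" "x \<in> mcarrier (rprod I A)"
  shows "rprod_cut I A {i} x = rprod_inj I A i (x i)"
  using assms by (auto simp: rprod_cut_def rprod_inj_def rprod_simps PiE_iff)

context
  fixes I :: "'i set" and A :: "'i \<Rightarrow> ('r::ring_1, 'm) rmod"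
  assumes A: "\<And>i. i \<in> I \<Longrightarrow> right_module (A i)"
begin

lemma rprod_cut_closed: "x \<in> mcarrier (rprod I A) \<Longrightarrow> rprod_cut I A S x \<in> mcarrier (rprod I A)"
  using A by (auto simp: rprod_cut_def rprod_simps PiE_iff mzero_closed)

lemma madd_rprod_cut:
  assumes x: "x \<in> mcarrier (rprod I A)"
  shows "madd (rprod I A) (rprod_cut I A (S \<inter> T) x) (rprod_cut I A (S - T) x) = rprod_cut I A S x"
  using x A unfolding rprod_cut_def
  by (auto simp: rprod_simps PiE_iff mzero_closed madd_zero_left madd_zero_right
      intro!: restrict_ext)

lemma rhom_rprod_cut_split:
  assumes "f \<in> rhom (rprod I A) M" "x \<in> mcarrier (rprod I A)"
  shows "f (rprod_cut I A S x) = madd M (f (rprod_cut I A (S \<inter> T) x)) (f (rprod_cut I A (S - T) x))"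
  using rhom_madd[OF assms(1) rprod_cut_closed rprod_cut_closed, OF assms(2,2)]
    madd_rprod_cut[OF assms(2)] by metis

lemma rprod_proj_rhom: "i \<in> I \<Longrightarrow> rprod_proj I A i \<in> rhom (rprod I A) (A i)"
  using A unfolding rprod_proj_def
  by (intro rhomI) (auto simp: rprod_simps PiE_iff madd_closed msmult_closed)

lemma rprod_inj_rhom: "i \<in> I \<Longrightarrow> rprod_inj I A i \<in> rhom (A i) (rprod I A)"
  using A unfolding rprod_inj_def
  by (intro rhomI)
    (auto simp: rprod_simps madd_closed msmult_closed mzero_closed madd_zero_left msmult_mzero
      intro!: restrict_ext)

lemma rprod_proj_inj:
  assumes "i \<in> I" "k \<in> I"
  shows "rprod_proj I A k \<circ>\<^bsub>A i\<^esub> rprod_inj I A i = (if k = i then id_on (A i) else hzero (A i) (A k))"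
  using assms rhom_closed[OF rprod_inj_rhom[OF assms(1)]]
  by (auto simp: compose_def rprod_proj_def rprod_inj_def hzero_def intro!: restrict_ext)

lemma rhom_eq_sum_if_rprod_cut:
  assumes M: "right_module M" and f: "f \<in> rhom (rprod I A) M"
    and "finite H" "H \<subseteq> I" and cut: "\<And>x. x \<in> mcarrier (rprod I A) \<Longrightarrow> f (rprod_cut I A H x) = f x"
  shows "f = (\<Otimes>\<^bsub>hom_group (rprod I A) M\<^esub>i\<in>H.
    (f \<circ>\<^bsub>A i\<^esub> rprod_inj I A i) \<circ>\<^bsub>rprod I A\<^esub> rprod_proj I A i)" (is "_ = finprod ?H ?g H")
proof -
  interpret comm_group "hom_group (rprod I A) M"
    by (rule comm_group_hom_group[OF right_module_rprod[OF A] M])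
  have g: "?g i \<in> rhom (rprod I A) M" if "i \<in> I" for i
    by (rule rhom_compose[OF right_module_rprod[OF A] rprod_proj_rhom[OF that]
          rhom_compose[OF A[OF that] rprod_inj_rhom[OF that] f]])
  have sum: "finprod ?H ?g K \<in> rhom (rprod I A) M" if "K \<subseteq> I" for K
    using finprod_closed[of ?g K] g that by auto
  have "finprod ?H ?g K x = f (rprod_cut I A K x)"
    if "finite K" "K \<subseteq> I" and x: "x \<in> mcarrier (rprod I A)" for K x
    using that(1,2)
  proof (induction K)
    case empty
    then show ?case
      using x rhom_mzero[OF right_module_rprod[OF A] M f]
      by (simp add: rprod_cut_empty hzero_def)
  next
    case (insert i K)
    have "finprod ?H ?g (insert i K) = ?g i \<otimes>\<^bsub>?H\<^esub> finprod ?H ?g K"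
      using insert.hyps insert.prems g by (intro finprod_insert) auto
    moreover have "?g i x = f (rprod_cut I A {i} x)"
      using x insert.prems rprod_cut_singleton[of i I x A]
      by (auto simp: compose_def rprod_proj_def rprod_simps PiE_iff)
    moreover have "insert i K \<inter> {i} = {i}" "insert i K - {i} = K"
      using insert.hyps by auto
    ultimately show ?case
      using insert rhom_rprod_cut_split[OF f x, of "insert i K" "{i}"] x by (simp add: hadd_def)
  qed
  then show ?thesis
    using assms(3,4) cut by (intro rhom_eqI[OF f sum]) auto
qed

end

lemma rprod_proj_sum_inj:
  assumes A: "\<And>i. i \<in> I \<Longrightarrow> right_module (A i)" and U: "right_module U"
    and F: "finite F" "F \<subseteq> I" and w: "\<And>i. i \<in> F \<Longrightarrow> w i \<in> rhom U (A i)" and k: "k \<in> F"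
  shows "rprod_proj I A k \<circ>\<^bsub>U\<^esub> (\<Otimes>\<^bsub>hom_group U (rprod I A)\<^esub>i\<in>F. rprod_inj I A i \<circ>\<^bsub>U\<^esub> w i) = w k"
proof -
  note prod = right_module_rprod[OF A]
  have kI: "k \<in> I" using F k by blast
  interpret comm_group "hom_group U (A k)"
    by (rule comm_group_hom_group[OF U A[OF kI]])
  have inj: "rprod_inj I A i \<circ>\<^bsub>U\<^esub> w i \<in> rhom U (rprod I A)" if "i \<in> F" for i
    using that F(2) by (intro rhom_compose[OF U w] rprod_inj_rhom[OF A]) auto
  have "rprod_proj I A k \<circ>\<^bsub>U\<^esub> (\<Otimes>\<^bsub>hom_group U (rprod I A)\<^esub>i\<in>F. rprod_inj I A i \<circ>\<^bsub>U\<^esub> w i)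
      = (\<Otimes>\<^bsub>hom_group U (A k)\<^esub>i\<in>F. rprod_proj I A k \<circ>\<^bsub>U\<^esub> (rprod_inj I A i \<circ>\<^bsub>U\<^esub> w i))"
    by (rule compose_sum[OF U prod A[OF kI] rprod_proj_rhom[OF A kI] inj])
  also have "\<dots> = (\<Otimes>\<^bsub>hom_group U (A k)\<^esub>i\<in>F. if k = i then w k else \<one>\<^bsub>hom_group U (A k)\<^esub>)"
  proof (rule finprod_cong')
    fix i assume i: "i \<in> F"
    then have "rprod_proj I A k \<circ>\<^bsub>U\<^esub> (rprod_inj I A i \<circ>\<^bsub>U\<^esub> w i) =
        (if k = i then id_on (A i) else hzero (A i) (A k)) \<circ>\<^bsub>U\<^esub> w i"
      using rprod_proj_inj[of I A, OF A subsetD[OF F(2) i] kI]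
      by (simp add: rhom_compose_assoc[OF w[OF i]])
    also have "\<dots> = (if k = i then w k else \<one>\<^bsub>hom_group U (A k)\<^esub>)"
      using rhom_id_compose[OF w[OF i]] rhom_closed[OF w[OF i]]
      by (auto simp: compose_def hzero_def intro!: restrict_ext)
    finally show "rprod_proj I A k \<circ>\<^bsub>U\<^esub> (rprod_inj I A i \<circ>\<^bsub>U\<^esub> w i) = \<dots>" .
  qed (use w[OF k] hzero_rhom[OF U A[OF kI]] in auto)
  also have "\<dots> = w k"
    using w[OF k] k F(1) by (intro finprod_singleton) auto
  finally show ?thesis .
qed

section \<open>Homomorphisms from products to slender modules\<close>

locale rhom_rprod_slender =
  fixes I :: "'i set" and A :: "'i \<Rightarrow> ('r::ring_1, 'm) rmod" and M :: "('r, 'n) rmod"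
    and f :: "('i \<Rightarrow> 'm) \<Rightarrow> 'n"
  assumes A: "\<And>i. i \<in> I \<Longrightarrow> right_module (A i)" and M: "right_module M"
    and slender: "slender M" and f: "f \<in> rhom (rprod I A) M"
begin

definition null_sets_along :: "('i \<Rightarrow> 'm) \<Rightarrow> 'i set set" where
  "null_sets_along a = {X. \<forall>Y\<subseteq>X. f (rprod_cut I A Y a) = mzero M}"

lemma apply_mzero: "f (mzero (rprod I A)) = mzero M"
  by (rule rhom_mzero[OF right_module_rprod[OF A] M f])

lemma apply_rprod_cut_closed: "a \<in> mcarrier (rprod I A) \<Longrightarrow> f (rprod_cut I A S a) \<in> mcarrier M"
  by (rule rhom_closed[OF f rprod_cut_closed[OF A]])

lemma rprod_cut_diff_null:
  assumes "a \<in> mcarrier (rprod I A)" "f (rprod_cut I A (S \<inter> T) a) = mzero M"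
  shows "f (rprod_cut I A (S - T) a) = f (rprod_cut I A S a)"
  using assms rhom_rprod_cut_split[OF A f assms(1), of S T]
  by (simp add: madd_zero_left[OF M] apply_rprod_cut_closed)

text \<open>Point-finiteness of \<open>S\<close> makes the sum over \<open>n\<close> of the multiples of the restrictions of \<open>a\<close> to
  \<open>S n\<close> a well-defined homomorphism from the countable power of the ring to the product.\<close>
lemma eventually_null_if_point_finite:
  fixes S :: "nat \<Rightarrow> 'i set"
  assumes a: "a \<in> mcarrier (rprod I A)" and finite: "\<And>i. i \<in> I \<Longrightarrow> finite {n. i \<in> S n}"
  shows "\<exists>n\<^sub>0. \<forall>n\<ge>n\<^sub>0. f (rprod_cut I A (S n) a) = mzero M"
proof -
  have ai: "a i \<in> mcarrier (A i)" if "i \<in> I" for i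
    using a that by (auto simp: rprod_simps)
  define \<phi> where "\<phi> = (\<lambda>y :: nat \<Rightarrow> 'r. \<lambda>i\<in>I. msmult (A i) (a i) (\<Sum>n | i \<in> S n. y n))"
  have "\<phi> \<in> rhom Romega (rprod I A)"
    using A ai
    by (intro rhomI)
      (auto simp: \<phi>_def Romega_def rprod_simps msmult_closed msmult_add msmult_mult sum.distrib
        sum_distrib_right[symmetric] intro!: restrict_ext)
  then have "f \<circ>\<^bsub>Romega\<^esub> \<phi> \<in> rhom Romega M"
    using f by (intro rhom_compose) (auto simp: right_module_def Romega_def algebra_simps)
  then obtain n\<^sub>0 where n\<^sub>0: "\<forall>n\<ge>n\<^sub>0. (f \<circ>\<^bsub>Romega\<^esub> \<phi>) (unit_vec n) = mzero M"
    using slender unfolding slender_def by blast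
  have "\<phi> (unit_vec n) = rprod_cut I A (S n) a" for n
  proof -
    have "(\<Sum>k | i \<in> S k. unit_vec n k) = (if i \<in> S n then 1 else 0 :: 'r)" if "i \<in> I" for i
      using finite[OF that] by (simp add: unit_vec_def)
    then show ?thesis
      using A ai by (auto simp: \<phi>_def rprod_cut_def msmult_one msmult_zero intro!: restrict_ext)
  qed
  then show ?thesis using n\<^sub>0 by (auto simp: compose_def Romega_def)
qed

lemma disjoint_family_null_set:
  fixes Z :: "nat \<Rightarrow> 'i set"
  assumes a: "a \<in> mcarrier (rprod I A)" and Z: "disjoint_family Z"
  shows "\<exists>n. Z n \<in> null_sets_along a"
proof (rule ccontr)
  assume "\<not> ?thesis"
  then obtain Y where Y: "\<And>n. Y n \<subseteq> Z n" "\<And>n. f (rprod_cut I A (Y n) a) \<noteq> mzero M"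
    unfolding null_sets_along_def by simp metis
  have "finite {n. i \<in> Y n}" for i
  proof -
    have "m = n" if "i \<in> Y m" "i \<in> Y n" for m n
      using that Y(1) Z unfolding disjoint_family_on_def by blast
    then have "\<exists>m. {n. i \<in> Y n} \<subseteq> {m}" by blast
    then show ?thesis using finite_subset by blast
  qed
  then show False using eventually_null_if_point_finite[OF a, of Y] Y(2) by blast
qed

lemma sigma_ideal_null_sets_along:
  assumes a: "a \<in> mcarrier (rprod I A)"
  shows "sigma_ideal (null_sets_along a)"
  unfolding sigma_ideal_def
proof (intro conjI ballI allI impI)
  show "{} \<in> null_sets_along a"
    using apply_mzero by (simp add: null_sets_along_def rprod_cut_empty)
  show "Y \<in> null_sets_along a" if "X \<in> null_sets_along a" "Y \<subseteq> X" for X Y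
    using that unfolding null_sets_along_def by blast
  fix X :: "nat \<Rightarrow> 'i set" assume X: "range X \<subseteq> null_sets_along a"
  have "f (rprod_cut I A Y a) = mzero M" if Y: "Y \<subseteq> (\<Union>n. X n)" for Y
  proof -
    define T where "T = (\<lambda>n. Y - (\<Union>k<n. X k))"
    have "finite {n. i \<in> T n}" for i
    proof (cases "i \<in> Y")
      case True
      then obtain k where "i \<in> X k" using Y by blast
      then have "{n. i \<in> T n} \<subseteq> {..k}" by (auto simp: T_def not_less[symmetric])
      then show ?thesis using finite_subset by blast
    qed (simp add: T_def)
    then obtain n where "f (rprod_cut I A (T n) a) = mzero M"
      using eventually_null_if_point_finite[OF a, of T] by blast
    moreover have "f (rprod_cut I A (T n) a) = f (rprod_cut I A Y a)" for n
    proof (induction n)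
      case (Suc n)
      have "T (Suc n) = T n - X n" by (auto simp: T_def lessThan_Suc)
      moreover have "f (rprod_cut I A (T n \<inter> X n) a) = mzero M"
        using X unfolding null_sets_along_def by blast
      ultimately show ?case using Suc rprod_cut_diff_null[OF a] by simp
    qed (simp add: T_def)
    ultimately show ?thesis by simp
  qed
  then show "(\<Union>n. X n) \<in> null_sets_along a" unfolding null_sets_along_def by blast
qed

lemma null_if_null_on_singletons:
  assumes "\<not> measurable_card I" and a: "a \<in> mcarrier (rprod I A)"
    and "\<And>i. i \<in> I \<Longrightarrow> f (rprod_cut I A {i} a) = mzero M"
  shows "f a = mzero M"
proof -
  have "I \<in> null_sets_along a"
  proof (rule nonmeasurable_in_sigma_ideal)
    show "{i} \<in> null_sets_along a" if "i \<in> I" for i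
      using assms(3)[OF that] apply_mzero
      by (auto simp: null_sets_along_def subset_singleton_iff rprod_cut_empty)
  qed (use assms sigma_ideal_null_sets_along disjoint_family_null_set in auto)
  then show ?thesis
    unfolding null_sets_along_def using rprod_cut_all[OF a] by auto
qed

lemma finite_nonzero_components:
  "finite {i \<in> I. f \<circ>\<^bsub>A i\<^esub> rprod_inj I A i \<noteq> hzero (A i) M}" (is "finite ?F")
proof (rule ccontr)
  assume "infinite ?F"
  then obtain e :: "nat \<Rightarrow> 'i" where "inj e" "range e \<subseteq> ?F"
    using infinite_countable_subset by blast
  have "\<forall>i\<in>?F. \<exists>y. y \<in> mcarrier (A i) \<and> f (rprod_inj I A i y) \<noteq> mzero M"
    by (auto simp: compose_def hzero_def restrict_def fun_eq_iff split: if_splits)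
  from bchoice[OF this] obtain y
    where y: "\<And>i. i \<in> ?F \<Longrightarrow> y i \<in> mcarrier (A i) \<and> f (rprod_inj I A i (y i)) \<noteq> mzero M"
    by blast
  define a where "a = (\<lambda>i\<in>I. if i \<in> ?F then y i else mzero (A i))"
  have a: "a \<in> mcarrier (rprod I A)"
    using y A by (auto simp: a_def rprod_simps mzero_closed)
  have "finite {n. i \<in> {e n}}" for i
    using finite_vimageI[OF _ \<open>inj e\<close>, of "{i}"] by (simp add: vimage_def eq_commute)
  then obtain n where "f (rprod_cut I A {e n} a) = mzero M"
    using eventually_null_if_point_finite[OF a, of "\<lambda>n. {e n}"] by blast
  moreover have e: "e n \<in> ?F" using \<open>range e \<subseteq> ?F\<close> by blast
  then have "rprod_cut I A {e n} a = rprod_inj I A (e n) (y (e n))"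
    using rprod_cut_singleton[OF _ a] by (simp add: a_def)
  ultimately show False using y[OF e] by simp
qed

lemma eq_finite_sum_of_components:
  assumes nonmeas: "\<not> measurable_card I"
  obtains H where "finite H" "H \<subseteq> I"
    "f = (\<Otimes>\<^bsub>hom_group (rprod I A) M\<^esub>i\<in>H.
      (f \<circ>\<^bsub>A i\<^esub> rprod_inj I A i) \<circ>\<^bsub>rprod I A\<^esub> rprod_proj I A i)"
proof -
  define H where "H = {i \<in> I. f \<circ>\<^bsub>A i\<^esub> rprod_inj I A i \<noteq> hzero (A i) M}"
  have H: "finite H" "H \<subseteq> I"
    using finite_nonzero_components by (auto simp: H_def)
  have "f (rprod_cut I A H x) = f x" if x: "x \<in> mcarrier (rprod I A)" for x
  proof -
    have "f (rprod_cut I A (I - H) x) = mzero M"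
    proof (rule null_if_null_on_singletons[OF nonmeas rprod_cut_closed[OF A x]])
      show "f (rprod_cut I A {i} (rprod_cut I A (I - H) x)) = mzero M" if "i \<in> I" for i
      proof (cases "i \<in> H")
        case True
        then show ?thesis using apply_mzero by (simp add: rprod_cut_rprod_cut rprod_cut_empty)
      next
        case False
        then have "(f \<circ>\<^bsub>A i\<^esub> rprod_inj I A i) (x i) = hzero (A i) M (x i)"
          using that by (simp add: H_def)
        then show ?thesis
          using that False x rprod_cut_singleton[OF that x]
          by (auto simp: rprod_cut_rprod_cut compose_def hzero_def rprod_simps PiE_iff)
      qed
    qed
    moreover have "I \<inter> (I - H) = I - H" "I - (I - H) = H" using H(2) by auto
    ultimately show ?thesis
      using rprod_cut_diff_null[OF x, of I "I - H"] rprod_cut_all[OF x] by simp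
  qed
  from that[OF H rhom_eq_sum_if_rprod_cut[OF A M f H this]] show thesis .
qed

end

section \<open>Bijections\<close>

lemma countable_bij_betw_if_finite_card_le:
  assumes "countable X" "countable Y"
    and "finite Y \<Longrightarrow> finite X \<and> card X \<le> card Y"
    and "finite X \<Longrightarrow> finite Y \<and> card Y \<le> card X"
  shows "\<exists>f. bij_betw f X Y"
proof (cases "finite X")
  case True
  then have "finite Y" "card X = card Y" using assms(3,4) by auto
  with True show ?thesis by (rule finite_same_card_bij)
next
  case False
  then have "infinite Y" using assms(3) by blast
  with False show ?thesis
    using bij_betw_trans[OF to_nat_on_infinite[OF assms(1)] bij_betw_from_nat_into[OF assms(2)]]
    by blast
qed

lemma bij_betw_if_bij_betw_fibres:
  assumes "\<And>k. \<exists>f. bij_betw f {i \<in> I. c i = k} {j \<in> J. d j = k}"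
  shows "\<exists>\<sigma>. bij_betw \<sigma> I J \<and> (\<forall>i\<in>I. d (\<sigma> i) = c i)"
proof -
  obtain f where f: "\<And>k. bij_betw (f k) {i \<in> I. c i = k} {j \<in> J. d j = k}"
    using assms by metis
  define \<sigma> where "\<sigma> = (\<lambda>i. f (c i) i)"
  have \<sigma>: "bij_betw \<sigma> {i \<in> I. c i = k} {j \<in> J. d j = k}" for k
    using f[of k] by (rule bij_betw_cong[THEN iffD1, rotated]) (auto simp: \<sigma>_def)
  then have "bij_betw \<sigma> (\<Union>k. {i \<in> I. c i = k}) (\<Union>k. {j \<in> J. d j = k})"
    by (intro bij_betw_UNION_disjoint) (auto simp: disjoint_family_on_def)
  moreover have "(\<Union>k. {i \<in> I. c i = k}) = I" "(\<Union>k. {j \<in> J. d j = k}) = J" by auto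
  moreover have "d (\<sigma> i) = c i" if "i \<in> I" for i
    using bij_betwE[OF \<sigma>[of "c i"]] that by blast
  ultimately show ?thesis by auto
qed

section \<open>Completely prime ideals\<close>

locale completely_prime =
  fixes C :: "('r::ring_1, 'm) rmod set"
    and P :: "('r, 'm) rmod \<Rightarrow> ('r, 'm) rmod \<Rightarrow> ('m \<Rightarrow> 'm) set"
  assumes modules: "M \<in> C \<Longrightarrow> right_module M"
    and prime: "completely_prime_ideal C P"
begin

lemma subgroup_P: "M \<in> C \<Longrightarrow> N \<in> C \<Longrightarrow> subgroup (P M N) (hom_group M N)"
  using prime hom_subgroup_iff_subgroup modules unfolding completely_prime_ideal_def by blast

lemma P_subset_rhom: "M \<in> C \<Longrightarrow> N \<in> C \<Longrightarrow> P M N \<subseteq> rhom M N"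
  using subgroup.subset[OF subgroup_P] by simp

lemma P_ne_rhom_iff: "M \<in> C \<Longrightarrow> N \<in> C \<Longrightarrow> P M N \<noteq> rhom M N \<longleftrightarrow> (\<exists>f\<in>rhom M N. f \<notin> P M N)"
  using P_subset_rhom by blast

lemma compose_in_P_iff:
  assumes "M \<in> C" "N \<in> C" "K \<in> C" "f \<in> rhom M N" "g \<in> rhom N K"
  shows "g \<circ>\<^bsub>M\<^esub> f \<in> P M K \<longleftrightarrow> f \<in> P M N \<or> g \<in> P N K"
  using assms prime unfolding completely_prime_ideal_def by blast

lemma P_ne_rhom_trans:
  assumes "M \<in> C" "N \<in> C" "K \<in> C" "P M N \<noteq> rhom M N" "P N K \<noteq> rhom N K"
  shows "P M K \<noteq> rhom M K"
proof -
  obtain f g where "f \<in> rhom M N" "f \<notin> P M N" "g \<in> rhom N K" "g \<notin> P N K"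
    using assms P_ne_rhom_iff by metis
  then show ?thesis
    using assms(1-3) compose_in_P_iff rhom_compose[OF modules] by metis
qed

lemma same_class_refl: "M \<in> C \<Longrightarrow> same_class P M M"
  using prime unfolding completely_prime_ideal_def same_class_def by blast

lemma same_class_sym: "same_class P M N \<Longrightarrow> same_class P N M"
  by (auto simp: same_class_def)

lemma same_class_trans:
  assumes "M \<in> C" "N \<in> C" "K \<in> C" "same_class P M N" "same_class P N K"
  shows "same_class P M K"
  using assms P_ne_rhom_trans unfolding same_class_def by blast

definition P_class :: "('r, 'm) rmod \<Rightarrow> ('r, 'm) rmod set" where
  "P_class M = {N \<in> C. same_class P N M}"

lemma P_class_eq_iff:
  assumes "M \<in> C" "N \<in> C"
  shows "P_class M = P_class N \<longleftrightarrow> same_class P M N"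
proof
  assume "P_class M = P_class N"
  then have "M \<in> P_class N"
    using same_class_refl assms(1) by (auto simp: P_class_def)
  then show "same_class P M N" by (simp add: P_class_def)
next
  assume "same_class P M N"
  then show "P_class M = P_class N"
    using assms same_class_trans same_class_sym unfolding P_class_def by blast
qed

lemma countable_P_class_fibre:
  assumes A: "\<And>i. i \<in> I \<Longrightarrow> A i \<in> C"
    and "\<And>i. i \<in> I \<Longrightarrow> countable {k \<in> I. same_class P (A k) (A i)}"
  shows "countable {i \<in> I. P_class (A i) = K}"
proof (cases "{i \<in> I. P_class (A i) = K} = {}")
  case False
  then obtain i where i: "i \<in> I" "P_class (A i) = K" by blast
  then have "{i \<in> I. P_class (A i) = K} = {k \<in> I. same_class P (A k) (A i)}"
    using A by (auto simp: P_class_eq_iff[symmetric])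
  then show ?thesis using assms(2)[OF i(1)] by simp
qed (simp only: countable_empty)

lemma ideal_P:
  assumes M: "M \<in> C"
  shows "ideal (P M M) (end_ring M)"
proof (rule idealI)
  show "ring (end_ring M)"
    by (rule ring_end_ring[OF modules[OF M]])
  show "subgroup (P M M) (add_monoid (end_ring M))"
    using subgroup_P[OF M M] by (simp only: add_monoid_end_ring)
qed (use compose_in_P_iff[OF M M M] P_subset_rhom[OF M M] in auto)

lemma in_P_if_not_same_class:
  assumes "M \<in> C" "N \<in> C" "K \<in> C" and f: "f \<in> rhom M N" and g: "g \<in> rhom N K"
    and "same_class P K M" "\<not> same_class P N M"
  shows "f \<in> P M N \<or> g \<in> P N K"
proof (rule ccontr)
  assume "\<not> ?thesis"
  then have "P M N \<noteq> rhom M N" "P N K \<noteq> rhom N K" using f g by auto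
  then have "same_class P N M"
    using assms(1-3,6) P_ne_rhom_trans[of N K M] by (simp add: same_class_def)
  with assms(7) show False by blast
qed

lemma sum_in_P:
  assumes "M \<in> C" "N \<in> C" "\<And>i. i \<in> F \<Longrightarrow> f i \<in> P M N"
  shows "(\<Otimes>\<^bsub>hom_group M N\<^esub>i\<in>F. f i) \<in> P M N"
  by (rule comm_group.finprod_subgroup_closed[OF comm_group_hom_group subgroup_P])
    (use assms modules in auto)

lemma compose_in_P_if_components_in_P:
  assumes B: "\<And>j. j \<in> J \<Longrightarrow> B j \<in> C" and U: "U \<in> C" and M: "M \<in> C"
    and "slender M" "\<not> measurable_card J"
    and v: "v \<in> rhom U (rprod J B)" and f: "f \<in> rhom (rprod J B) M"
    and components: "\<And>j. j \<in> J \<Longrightarrow>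
      rprod_proj J B j \<circ>\<^bsub>U\<^esub> v \<in> P U (B j) \<or> f \<circ>\<^bsub>B j\<^esub> rprod_inj J B j \<in> P (B j) M"
  shows "f \<circ>\<^bsub>U\<^esub> v \<in> P U M"
proof -
  note mB = modules[OF B] and mU = modules[OF U] and mM = modules[OF M]
  note prod = right_module_rprod[of J B, OF mB]
  interpret f: rhom_rprod_slender J B M f
    using mB mM f \<open>slender M\<close> by unfold_locales
  obtain H where "finite H" "H \<subseteq> J"
    and sum: "f = (\<Otimes>\<^bsub>hom_group (rprod J B) M\<^esub>j\<in>H.
      (f \<circ>\<^bsub>B j\<^esub> rprod_inj J B j) \<circ>\<^bsub>rprod J B\<^esub> rprod_proj J B j)"
    using f.eq_finite_sum_of_components[OF \<open>\<not> measurable_card J\<close>] .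
  have inj: "f \<circ>\<^bsub>B j\<^esub> rprod_inj J B j \<in> rhom (B j) M" if "j \<in> J" for j
    by (rule rhom_compose[OF mB[OF that] rprod_inj_rhom[OF mB that] f])
  have proj: "rprod_proj J B j \<in> rhom (rprod J B) (B j)" if "j \<in> J" for j
    by (rule rprod_proj_rhom[OF mB that])
  have "f \<circ>\<^bsub>U\<^esub> v = (\<Otimes>\<^bsub>hom_group U M\<^esub>j\<in>H.
      ((f \<circ>\<^bsub>B j\<^esub> rprod_inj J B j) \<circ>\<^bsub>rprod J B\<^esub> rprod_proj J B j) \<circ>\<^bsub>U\<^esub> v)"
    using rhom_compose[OF prod proj inj] \<open>H \<subseteq> J\<close>
    by (subst sum, intro sum_compose[OF mU prod mM v]) auto
  also have "\<dots> \<in> P U M"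
  proof (rule sum_in_P[OF U M])
    fix j assume "j \<in> H"
    then have j: "j \<in> J" using \<open>H \<subseteq> J\<close> by blast
    then have "(f \<circ>\<^bsub>B j\<^esub> rprod_inj J B j) \<circ>\<^bsub>U\<^esub> rprod_proj J B j \<circ>\<^bsub>U\<^esub> v \<in> P U M"
      using components compose_in_P_iff[OF U B M rhom_compose[OF mU v proj] inj] by blast
    then show "((f \<circ>\<^bsub>B j\<^esub> rprod_inj J B j) \<circ>\<^bsub>rprod J B\<^esub> rprod_proj J B j) \<circ>\<^bsub>U\<^esub> v \<in> P U M"
      by (simp add: rhom_compose_assoc[OF v])
  qed
  finally show ?thesis .
qed

end

locale completely_prime_maximal = completely_prime +
  assumes maximal: "M \<in> C \<Longrightarrow> end_maximal_right_ideal M (P M M)"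
begin

lemma right_inverse_mod_P:
  assumes M: "M \<in> C" and k: "k \<in> carrier (end_ring M)" "k \<notin> P M M"
  shows "\<exists>s\<in>carrier (end_ring M). k \<otimes>\<^bsub>end_ring M\<^esub> s \<ominus>\<^bsub>end_ring M\<^esub> \<one>\<^bsub>end_ring M\<^esub> \<in> P M M"
proof -
  let ?E = "end_ring M"
  interpret ideal "P M M" ?E by (rule ideal_P[OF M])
  define Q where "Q = P M M <+>\<^bsub>?E\<^esub> (\<lambda>s. k \<otimes>\<^bsub>?E\<^esub> s) ` carrier ?E"
  have Q_iff: "x \<in> Q \<longleftrightarrow> (\<exists>p\<in>P M M. \<exists>s\<in>carrier ?E. x = p \<oplus>\<^bsub>?E\<^esub> k \<otimes>\<^bsub>?E\<^esub> s)" for x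
    by (auto simp: Q_def set_add_def')
  have "p \<in> Q" if "p \<in> P M M" for p
    using that k(1) Icarr unfolding Q_iff
    by (intro bexI[of _ p] bexI[of _ "\<zero>\<^bsub>?E\<^esub>"]) (simp_all del: end_ring_simps)
  moreover have "k \<in> Q"
    using k(1) unfolding Q_iff
    by (intro bexI[of _ "\<zero>\<^bsub>?E\<^esub>"] bexI[of _ "\<one>\<^bsub>?E\<^esub>"]) (simp_all del: end_ring_simps)
  moreover have "end_right_ideal M Q"
    using maximal[OF M] k(1) unfolding Q_def end_maximal_right_ideal_def
    by (intro end_right_ideal_add_principal[OF modules[OF M]]) simp_all
  ultimately have "Q = rhom M M"
    using maximal[OF M] k(2) unfolding end_maximal_right_ideal_def by blast
  then have "\<one>\<^bsub>?E\<^esub> \<in> Q"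
    using one_closed by simp
  then obtain p s where p: "p \<in> P M M" and s: "s \<in> carrier ?E" and one: "\<one>\<^bsub>?E\<^esub> = p \<oplus>\<^bsub>?E\<^esub> k \<otimes>\<^bsub>?E\<^esub> s"
    unfolding Q_iff by blast
  have "k \<otimes>\<^bsub>?E\<^esub> s \<ominus>\<^bsub>?E\<^esub> \<one>\<^bsub>?E\<^esub> = \<ominus>\<^bsub>?E\<^esub> p"
    using Icarr[OF p] k(1) s
    by (simp add: one a_minus_def minus_add a_lcomm r_neg a_comm del: end_ring_simps)
  then show ?thesis
    using p s by (intro bexI[of _ s]) (simp_all del: end_ring_simps)
qed

lemma endomorphism_system_nontrivial_solution_mod_P:
  assumes U: "U \<in> C" and X: "right_module X"
    and y: "\<And>i. i \<in> F \<Longrightarrow> y i \<in> rhom U X" and z: "\<And>j. j \<in> G \<Longrightarrow> z j \<in> rhom X U"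
    and card: "finite G" "finite F" "card G < card F"
  shows "\<exists>e\<in>F \<rightarrow> rhom U U. (\<exists>i\<in>F. e i \<notin> P U U) \<and>
    (\<forall>j\<in>G. z j \<circ>\<^bsub>U\<^esub> (\<Otimes>\<^bsub>hom_group U X\<^esub>i\<in>F. y i \<circ>\<^bsub>U\<^esub> e i) \<in> P U U)"
proof -
  let ?E = "end_ring U"
  interpret ideal "P U U" ?E by (rule ideal_P[OF U])
  note mU = modules[OF U]
  have zy: "z j \<circ>\<^bsub>U\<^esub> y i \<in> rhom U U" if "i \<in> F" "j \<in> G" for i j
    by (rule rhom_compose[OF mU y[OF that(1)] z[OF that(2)]])
  have "\<exists>e\<in>F \<rightarrow> carrier ?E. (\<exists>i\<in>F. e i \<notin> P U U) \<and>
      (\<forall>j\<in>G. (\<Oplus>\<^bsub>?E\<^esub>i\<in>F. (z j \<circ>\<^bsub>U\<^esub> y i) \<otimes>\<^bsub>?E\<^esub> e i) \<in> P U U)"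
    using card right_inverse_mod_P[OF U] zy same_class_refl[OF U]
    by (intro homogeneous_system_nontrivial_solution_mod) (auto simp: same_class_def)
  then obtain e where e: "\<And>i. i \<in> F \<Longrightarrow> e i \<in> rhom U U" "\<exists>i\<in>F. e i \<notin> P U U"
    and solution: "\<And>j. j \<in> G \<Longrightarrow> (\<Otimes>\<^bsub>hom_group U U\<^esub>i\<in>F. (z j \<circ>\<^bsub>U\<^esub> y i) \<circ>\<^bsub>U\<^esub> e i) \<in> P U U"
    by (auto simp: finsum_end_ring)
  have "z j \<circ>\<^bsub>U\<^esub> (\<Otimes>\<^bsub>hom_group U X\<^esub>i\<in>F. y i \<circ>\<^bsub>U\<^esub> e i) \<in> P U U" if j: "j \<in> G" for j
  proof -
    have "z j \<circ>\<^bsub>U\<^esub> (\<Otimes>\<^bsub>hom_group U X\<^esub>i\<in>F. y i \<circ>\<^bsub>U\<^esub> e i) = (\<Otimes>\<^bsub>hom_group U U\<^esub>i\<in>F. z j \<circ>\<^bsub>U\<^esub> y i \<circ>\<^bsub>U\<^esub> e i)"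
      by (rule compose_sum[OF mU X mU z[OF j] rhom_compose[OF mU e(1) y]])
    also have "\<dots> = (\<Otimes>\<^bsub>hom_group U U\<^esub>i\<in>F. (z j \<circ>\<^bsub>U\<^esub> y i) \<circ>\<^bsub>U\<^esub> e i)"
      using rhom_compose[OF mU e(1) zy[OF _ j]]
      by (intro sum_rhom_cong[OF mU mU] rhom_compose_assoc[OF e(1)])
    finally show ?thesis using solution[OF j] by simp
  qed
  with e show ?thesis by blast
qed

lemma product_system_nontrivial_solution_mod_P:
  assumes U: "U \<in> C" and A: "\<And>i. i \<in> I \<Longrightarrow> A i \<in> C" and B: "\<And>j. j \<in> G \<Longrightarrow> B j \<in> C"
    and F: "finite F" "F \<subseteq> I" and "finite G" "card G < card F"
    and UA: "\<And>i. i \<in> F \<Longrightarrow> P U (A i) \<noteq> rhom U (A i)"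
    and BU: "\<And>j. j \<in> G \<Longrightarrow> P (B j) U \<noteq> rhom (B j) U"
    and v: "\<And>j. j \<in> G \<Longrightarrow> v j \<in> rhom (rprod I A) (B j)"
  obtains w i where "w \<in> rhom U (rprod I A)" "i \<in> F" "rprod_proj I A i \<circ>\<^bsub>U\<^esub> w \<notin> P U (A i)"
    "\<And>j. j \<in> G \<Longrightarrow> v j \<circ>\<^bsub>U\<^esub> w \<in> P U (B j)"
proof -
  note mA = modules[OF A] and mU = modules[OF U]
  note prod_A = right_module_rprod[of I A, OF mA]
  have AF: "A i \<in> C" if "i \<in> F" for i using that F(2) A by blast
  obtain h where h: "\<And>i. i \<in> F \<Longrightarrow> h i \<in> rhom U (A i)" "\<And>i. i \<in> F \<Longrightarrow> h i \<notin> P U (A i)"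
    using UA P_ne_rhom_iff[OF U AF] by metis
  obtain k where k: "\<And>j. j \<in> G \<Longrightarrow> k j \<in> rhom (B j) U" "\<And>j. j \<in> G \<Longrightarrow> k j \<notin> P (B j) U"
    using BU P_ne_rhom_iff[OF B U] by metis
  define y where "y = (\<lambda>i. rprod_inj I A i \<circ>\<^bsub>U\<^esub> h i)"
  have y: "y i \<in> rhom U (rprod I A)" if "i \<in> F" for i
    unfolding y_def using that F(2) by (intro rhom_compose[OF mU h(1)] rprod_inj_rhom[OF mA]) auto
  have kv: "k j \<circ>\<^bsub>rprod I A\<^esub> v j \<in> rhom (rprod I A) U" if "j \<in> G" for j
    by (rule rhom_compose[OF prod_A v[OF that] k(1)[OF that]])
  obtain e where e: "\<And>i. i \<in> F \<Longrightarrow> e i \<in> rhom U U" "\<exists>i\<in>F. e i \<notin> P U U"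
    and solution: "\<And>j. j \<in> G \<Longrightarrow> (k j \<circ>\<^bsub>rprod I A\<^esub> v j) \<circ>\<^bsub>U\<^esub>
      (\<Otimes>\<^bsub>hom_group U (rprod I A)\<^esub>i\<in>F. y i \<circ>\<^bsub>U\<^esub> e i) \<in> P U U"
    using endomorphism_system_nontrivial_solution_mod_P[of U "rprod I A" F y G
        "\<lambda>j. k j \<circ>\<^bsub>rprod I A\<^esub> v j"] U prod_A y kv F(1) \<open>finite G\<close> \<open>card G < card F\<close> by blast
  define w where "w = (\<Otimes>\<^bsub>hom_group U (rprod I A)\<^esub>i\<in>F. y i \<circ>\<^bsub>U\<^esub> e i)"
  have w: "w \<in> rhom U (rprod I A)"
    unfolding w_def by (rule sum_rhom[OF mU prod_A rhom_compose[OF mU e(1) y]])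
  obtain i where i: "i \<in> F" "e i \<notin> P U U" using e(2) by blast
  have he: "h i \<circ>\<^bsub>U\<^esub> e i \<in> rhom U (A i)" if "i \<in> F" for i
    by (rule rhom_compose[OF mU e(1)[OF that] h(1)[OF that]])
  have "w = (\<Otimes>\<^bsub>hom_group U (rprod I A)\<^esub>i\<in>F. rprod_inj I A i \<circ>\<^bsub>U\<^esub> h i \<circ>\<^bsub>U\<^esub> e i)"
    unfolding w_def using rhom_compose[OF mU e(1) y]
    by (intro sum_rhom_cong[OF mU prod_A]) (simp_all add: y_def rhom_compose_assoc[OF e(1)])
  then have "rprod_proj I A i \<circ>\<^bsub>U\<^esub> w = h i \<circ>\<^bsub>U\<^esub> e i"
    using rprod_proj_sum_inj[OF mA mU F he i(1)] by simp
  then have "rprod_proj I A i \<circ>\<^bsub>U\<^esub> w \<notin> P U (A i)"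
    using compose_in_P_iff[OF U U AF e(1) h(1)] i h(2) by simp
  moreover have "v j \<circ>\<^bsub>U\<^esub> w \<in> P U (B j)" if j: "j \<in> G" for j
  proof -
    have "k j \<circ>\<^bsub>U\<^esub> v j \<circ>\<^bsub>U\<^esub> w \<in> P U U"
      using solution[OF j] by (simp add: w_def[symmetric] rhom_compose_assoc[OF w])
    then show ?thesis
      using compose_in_P_iff[OF U B[OF j] U rhom_compose[OF mU w v[OF j]] k(1)[OF j]] k(2)[OF j]
      by blast
  qed
  ultimately show thesis using that[OF w i(1)] by blast
qed

lemma card_same_class_le:
  assumes A: "\<And>i. i \<in> I \<Longrightarrow> A i \<in> C" and B: "\<And>j. j \<in> J \<Longrightarrow> B j \<in> C" and U: "U \<in> C"
    and slender: "\<And>i. i \<in> I \<Longrightarrow> slender (A i)" and nonmeas: "\<not> measurable_card J"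
    and \<alpha>: "\<alpha> \<in> rhom (rprod I A) (rprod J B)" and \<beta>: "\<beta> \<in> rhom (rprod J B) (rprod I A)"
    and inverse: "\<beta> \<circ>\<^bsub>rprod I A\<^esub> \<alpha> = id_on (rprod I A)"
    and finite: "finite {j \<in> J. same_class P (B j) U}" (is "finite ?G")
  shows "finite {i \<in> I. same_class P (A i) U} \<and>
    card {i \<in> I. same_class P (A i) U} \<le> card {j \<in> J. same_class P (B j) U}"
proof (rule finite_if_finite_subsets_card_bdd, rule ccontr)
  fix F assume F: "F \<subseteq> {i \<in> I. same_class P (A i) U}" "finite F" and "\<not> card F \<le> card ?G"
  note mA = modules[OF A] and mB = modules[OF B] and mU = modules[OF U]
  note prod_A = right_module_rprod[of I A, OF mA] and prod_B = right_module_rprod[of J B, OF mB]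
  have proj: "rprod_proj J B j \<in> rhom (rprod J B) (B j)" if "j \<in> J" for j
    by (rule rprod_proj_rhom[OF mB that])
  obtain w i where w: "w \<in> rhom U (rprod I A)" and i: "i \<in> F"
    and not_in_P: "rprod_proj I A i \<circ>\<^bsub>U\<^esub> w \<notin> P U (A i)"
    and in_P: "\<And>j. j \<in> ?G \<Longrightarrow> (rprod_proj J B j \<circ>\<^bsub>rprod I A\<^esub> \<alpha>) \<circ>\<^bsub>U\<^esub> w \<in> P U (B j)"
  proof (rule product_system_nontrivial_solution_mod_P[OF U A _ F(2) _ finite])
    show "rprod_proj J B j \<circ>\<^bsub>rprod I A\<^esub> \<alpha> \<in> rhom (rprod I A) (B j)" if "j \<in> ?G" for j
      using that by (intro rhom_compose[OF prod_A \<alpha> proj]) auto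
  qed (use F(1) \<open>\<not> card F \<le> card ?G\<close> B in \<open>auto simp: same_class_def\<close>)
  have iI: "i \<in> I" using i F(1) by blast
  have \<alpha>w: "\<alpha> \<circ>\<^bsub>U\<^esub> w \<in> rhom U (rprod J B)"
    by (rule rhom_compose[OF mU w \<alpha>])
  have \<beta>i: "rprod_proj I A i \<circ>\<^bsub>rprod J B\<^esub> \<beta> \<in> rhom (rprod J B) (A i)"
    by (rule rhom_compose[OF prod_B \<beta> rprod_proj_rhom[OF mA iI]])
  have "rprod_proj I A i \<circ>\<^bsub>U\<^esub> w = rprod_proj I A i \<circ>\<^bsub>U\<^esub> (\<beta> \<circ>\<^bsub>rprod I A\<^esub> \<alpha>) \<circ>\<^bsub>U\<^esub> w"
    using rhom_id_compose[OF w] by (simp add: inverse)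
  also have "\<dots> = (rprod_proj I A i \<circ>\<^bsub>rprod J B\<^esub> \<beta>) \<circ>\<^bsub>U\<^esub> \<alpha> \<circ>\<^bsub>U\<^esub> w"
    using rhom_compose_assoc[OF w] rhom_compose_assoc[OF \<alpha>w] by metis
  also have "\<dots> \<in> P U (A i)"
  proof (rule compose_in_P_if_components_in_P[OF B U A[OF iI] slender[OF iI] nonmeas \<alpha>w \<beta>i])
    fix j assume j: "j \<in> J"
    show "rprod_proj J B j \<circ>\<^bsub>U\<^esub> \<alpha> \<circ>\<^bsub>U\<^esub> w \<in> P U (B j) \<or>
      (rprod_proj I A i \<circ>\<^bsub>rprod J B\<^esub> \<beta>) \<circ>\<^bsub>B j\<^esub> rprod_inj J B j \<in> P (B j) (A i)"
    proof (cases "j \<in> ?G")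
      case True
      then show ?thesis using in_P by (simp add: rhom_compose_assoc[OF w])
    next
      case False
      then show ?thesis
        using i F(1) j
        by (intro in_P_if_not_same_class[OF U B[OF j] A[OF iI]] rhom_compose[OF mU \<alpha>w proj]
            rhom_compose[OF mB[OF j] rprod_inj_rhom[OF mB j] \<beta>i]) auto
    qed
  qed
  finally show False using not_in_P by blast
qed

lemma bij_betw_P_class_fibres:
  assumes A: "\<And>i. i \<in> I \<Longrightarrow> A i \<in> C" and B: "\<And>j. j \<in> J \<Longrightarrow> B j \<in> C"
    and slender: "\<And>i. i \<in> I \<Longrightarrow> slender (A i)" "\<And>j. j \<in> J \<Longrightarrow> slender (B j)"
    and nonmeas: "\<not> measurable_card I" "\<not> measurable_card J"
    and \<alpha>: "\<alpha> \<in> rhom (rprod I A) (rprod J B)" and \<beta>: "\<beta> \<in> rhom (rprod J B) (rprod I A)"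
    and inverse: "\<beta> \<circ>\<^bsub>rprod I A\<^esub> \<alpha> = id_on (rprod I A)" "\<alpha> \<circ>\<^bsub>rprod J B\<^esub> \<beta> = id_on (rprod J B)"
    and "\<And>i. i \<in> I \<Longrightarrow> countable {k \<in> I. same_class P (A k) (A i)}"
    and "\<And>j. j \<in> J \<Longrightarrow> countable {k \<in> J. same_class P (B k) (B j)}"
  shows "\<exists>f. bij_betw f {i \<in> I. P_class (A i) = K} {j \<in> J. P_class (B j) = K}"
proof (cases "\<exists>U\<in>C. K = P_class U")
  case True
  then obtain U where U: "U \<in> C" and K: "K = P_class U" by blast
  have fibres: "{i \<in> I. P_class (A i) = K} = {i \<in> I. same_class P (A i) U}"
    "{j \<in> J. P_class (B j) = K} = {j \<in> J. same_class P (B j) U}"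
    unfolding K using P_class_eq_iff[OF A U] P_class_eq_iff[OF B U] by blast+
  show ?thesis
  proof (rule countable_bij_betw_if_finite_card_le)
    show "countable {i \<in> I. P_class (A i) = K}" "countable {j \<in> J. P_class (B j) = K}"
      by (rule countable_P_class_fibre; use assms in blast)+
  qed (use card_same_class_le[OF A B U slender(1) nonmeas(2) \<alpha> \<beta> inverse(1)]
      card_same_class_le[OF B A U slender(2) nonmeas(1) \<beta> \<alpha> inverse(2)] in \<open>simp_all add: fibres\<close>)
next
  case False
  then have "{i \<in> I. P_class (A i) = K} = {}" "{j \<in> J. P_class (B j) = K} = {}"
    using A B by auto
  then show ?thesis by (simp only: bij_betw_def inj_on_empty image_empty simp_thms)
qed

end

theorem theorem5p5:
  fixes C :: "('r::ring_1, 'm) rmod set"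
    and P :: "('r, 'm) rmod \<Rightarrow> ('r, 'm) rmod \<Rightarrow> ('m \<Rightarrow> 'm) set"
    and I :: "'i set" and A :: "'i \<Rightarrow> ('r, 'm) rmod"
    and J :: "'j set" and B :: "'j \<Rightarrow> ('r, 'm) rmod"
  assumes modules: "\<forall>M\<in>C. right_module M"
    and slender: "\<forall>M\<in>C. slender M"
    and prime: "completely_prime_ideal C P"
    and A_in: "\<forall>i\<in>I. A i \<in> C"
    and B_in: "\<forall>j\<in>J. B j \<in> C"
    and I_nonmeas: "\<not> measurable_card I"
    and J_nonmeas: "\<not> measurable_card J"
    and max_ideal: "\<forall>M\<in>C. end_maximal_right_ideal M (P M M)"
    and count_A: "\<forall>i\<in>I. countable {i'\<in>I. same_class P (A i') (A i)}"
    and count_B: "\<forall>j\<in>J. countable {j'\<in>J. same_class P (B j') (B j)}"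
    and iso: "rmod_iso (rprod I A) (rprod J B)"
  shows "\<exists>\<sigma>. bij_betw \<sigma> I J \<and> (\<forall>i\<in>I. same_class P (A i) (B (\<sigma> i)))"
proof -
  interpret completely_prime_maximal C P
    using modules prime max_ideal by unfold_locales auto
  have A: "A i \<in> C" if "i \<in> I" for i using A_in that by blast
  have B: "B j \<in> C" if "j \<in> J" for j using B_in that by blast
  obtain \<alpha> \<beta> where "\<alpha> \<in> rhom (rprod I A) (rprod J B)" "\<beta> \<in> rhom (rprod J B) (rprod I A)"
    and "\<beta> \<circ>\<^bsub>rprod I A\<^esub> \<alpha> = id_on (rprod I A)" "\<alpha> \<circ>\<^bsub>rprod J B\<^esub> \<beta> = id_on (rprod J B)"
    using rmod_isoE[OF right_module_rprod iso] A modules by blast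
  then have "\<exists>f. bij_betw f {i \<in> I. P_class (A i) = K} {j \<in> J. P_class (B j) = K}" for K
    using A B slender I_nonmeas J_nonmeas count_A count_B
    by (intro bij_betw_P_class_fibres[where \<alpha> = \<alpha> and \<beta> = \<beta>]) auto
  from bij_betw_if_bij_betw_fibres[OF this] obtain \<sigma>
    where \<sigma>: "bij_betw \<sigma> I J" "\<forall>i\<in>I. P_class (B (\<sigma> i)) = P_class (A i)"
    by blast
  have "same_class P (A i) (B (\<sigma> i))" if "i \<in> I" for i
    using \<sigma> that P_class_eq_iff[OF A[OF that] B] bij_betwE by metis
  with \<sigma>(1) show ?thesis by blast
qed

end
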